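(* Let $0<\varepsilon\le 0.04$. Let $\mathcal{A}$ be any randomized $\mathsf{LOCAL}$ algorithm that, for every graph $G=(V,E)$, computes a dominating set $D\subseteq V$ with $\mathbb{E}[|D|]\le(1+\varepsilon)\gamma(G)$, where $\gamma(G)$ is the size of a minimum dominating set of $G$. Then the round complexity of $\mathcal{A}$ is $\Omega\left(\frac{\log n}{\varepsilon}\right)$, where $n=|V|$.
   Context: The $\mathsf{LOCAL}$ model on the graph $G$: synchronous rounds; in each round every vertex receives messages from its neighbours, performs arbitrary local computation and sends arbitrarily large messages to its neighbours; vertices are anonymous and have independent local random bits; the exact number of vertices $n$ is known to all vertices. A dominating set is a set $D$ such that every vertex is in $D$ or adjacent to a vertex of $D$. Each vertex outputs whether it is in $D$. *)

theory Defs
  imports "HOL-Probability.Probability"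
begin

section \<open>Graphs and dominating sets\<close>

text \<open>
  Finite simple undirected graphs. The vertices are taken from \<^typ>\<open>nat\<close>, which covers every
  finite graph up to isomorphism; vertex names are never visible to an algorithm.
\<close>

definition simple_graph :: "nat set \<Rightarrow> nat set set \<Rightarrow> bool" where
  "simple_graph V E \<longleftrightarrow>
     finite V \<and> (\<forall>e\<in>E. \<exists>u\<in>V. \<exists>v\<in>V. u \<noteq> v \<and> e = {u, v})"

definition neighbours :: "nat set set \<Rightarrow> nat \<Rightarrow> nat set" where
  "neighbours E v = {u. {u, v} \<in> E}"

definition dominating_set :: "nat set \<Rightarrow> nat set set \<Rightarrow> nat set \<Rightarrow> bool" where
  "dominating_set V E D \<longleftrightarrow> D \<subseteq> V \<and> (\<forall>v\<in>V. v \<in> D \<or> neighbours E v \<inter> D \<noteq> {})"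

definition domination_number :: "nat set \<Rightarrow> nat set set \<Rightarrow> nat" where
  "domination_number V E = Min (card ` {D. dominating_set V E D})"


section \<open>Randomized algorithms in the LOCAL model\<close>

text \<open>
  Vertices are anonymous: a vertex distinguishes its neighbours only by ports. A port numbering
  lists, for every vertex \<open>v\<close>, the neighbours of \<open>v\<close> in some order; port \<open>i\<close> of \<open>v\<close> leads to
  \<open>P v ! i\<close>. Algorithms that ignore the ports are included as a special case.
\<close>

definition port_numbering :: "nat set \<Rightarrow> nat set set \<Rightarrow> (nat \<Rightarrow> nat list) \<Rightarrow> bool" where
  "port_numbering V E P \<longleftrightarrow> (\<forall>v\<in>V. distinct (P v) \<and> set (P v) = neighbours E v)"

definition network :: "nat set \<Rightarrow> nat set set \<Rightarrow> (nat \<Rightarrow> nat list) \<Rightarrow> bool" where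
  "network V E P \<longleftrightarrow> simple_graph V E \<and> port_numbering V E P"

definition port_to :: "(nat \<Rightarrow> nat list) \<Rightarrow> nat \<Rightarrow> nat \<Rightarrow> nat" where
  "port_to P u v = (THE j. j < length (P u) \<and> P u ! j = v)"

text \<open>
  Infinite bit strings serve as random tapes, local states and messages. This type is large enough
  for unrestricted algorithms: everything a vertex can learn in finitely many rounds is a finite
  structure built from numbers and random tapes, and all such structures together can be encoded
  injectively in \<^typ>\<open>nat \<Rightarrow> bool\<close>. A type parameter for states and messages is avoided, because
  then constants in asymptotic bounds could depend on that type.
\<close>

type_synonym bits = "nat \<Rightarrow> bool"

text \<open>
  \<open>init\<close> gets the number of vertices, the degree of the vertex and its random tape; \<open>send\<close> gives
  the message to be sent through each port; \<open>receive\<close> gets the messages received in the order of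
  the ports. The functions are arbitrary, as local computation is not restricted. The value of
  \<open>decision\<close> is \<^term>\<open>None\<close> while the vertex is undecided, and otherwise states whether the vertex
  belongs to the output set. A decided vertex may go on sending messages.
\<close>

record local_alg =
  init :: "nat \<Rightarrow> nat \<Rightarrow> bits \<Rightarrow> bits"
  send :: "bits \<Rightarrow> nat \<Rightarrow> bits"
  receive :: "bits \<Rightarrow> bits list \<Rightarrow> bits"
  decision :: "bits \<Rightarrow> bool option"

text \<open>\<open>state_at A V P \<omega> t v\<close> is the state of \<open>v\<close> after \<open>t\<close> rounds if each vertex \<open>u\<close> has tape \<open>\<omega> u\<close>.\<close>

fun state_at :: "local_alg \<Rightarrow> nat set \<Rightarrow> (nat \<Rightarrow> nat list) \<Rightarrow> (nat \<Rightarrow> bits) \<Rightarrow> nat \<Rightarrow> nat \<Rightarrow> bits" where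
  "state_at A V P \<omega> 0 v = init A (card V) (length (P v)) (\<omega> v)"
| "state_at A V P \<omega> (Suc t) v =
     receive A (state_at A V P \<omega> t v)
       (map (\<lambda>u. send A (state_at A V P \<omega> t u) (port_to P u v)) (P v))"

definition decision_at ::
    "local_alg \<Rightarrow> nat set \<Rightarrow> (nat \<Rightarrow> nat list) \<Rightarrow> (nat \<Rightarrow> bits) \<Rightarrow> nat \<Rightarrow> nat \<Rightarrow> bool option" where
  "decision_at A V P \<omega> t v = decision A (state_at A V P \<omega> t v)"

definition output_set :: "local_alg \<Rightarrow> nat set \<Rightarrow> (nat \<Rightarrow> nat list) \<Rightarrow> (nat \<Rightarrow> bits) \<Rightarrow> nat set" where
  "output_set A V P \<omega> = {v \<in> V. \<exists>t. decision_at A V P \<omega> t v = Some True}"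

definition fair_coin_flips :: "bits measure" where
  "fair_coin_flips = PiM UNIV (\<lambda>_. measure_pmf (bernoulli_pmf (1/2)))"

definition random_tapes :: "nat set \<Rightarrow> (nat \<Rightarrow> bits) measure" where
  "random_tapes V = PiM V (\<lambda>_. fair_coin_flips)"

text \<open>
  Decisions are irrevocable. Measurability is required only of the decisions, so that probabilities
  and expectations concerning the output are meaningful.
\<close>

definition randomized_local_algorithm :: "local_alg \<Rightarrow> bool" where
  "randomized_local_algorithm A \<longleftrightarrow>
     (\<forall>s ms b. decision A s = Some b \<longrightarrow> decision A (receive A s ms) = Some b) \<and>
     (\<forall>V E P t. \<forall>v\<in>V. network V E P \<longrightarrow>
        (\<lambda>\<omega>. decision_at A V P \<omega> t v) \<in> measurable (random_tapes V) (count_space UNIV))"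

text \<open>
  The worst-case number of rounds until all vertices have decided, over all networks with \<open>n\<close>
  vertices; it is \<open>\<infinity>\<close> if there is no finite bound.
\<close>

definition round_complexity :: "local_alg \<Rightarrow> nat \<Rightarrow> enat" where
  "round_complexity A n = Inf {enat t |t. \<forall>V E P. network V E P \<and> card V = n \<longrightarrow>
     (AE \<omega> in random_tapes V. \<forall>v\<in>V. decision_at A V P \<omega> t v \<noteq> None)}"

definition approximates_dominating_set :: "local_alg \<Rightarrow> real \<Rightarrow> bool" where
  "approximates_dominating_set A \<epsilon> \<longleftrightarrow> (\<forall>V E P. network V E P \<longrightarrow>
     (AE \<omega> in random_tapes V. (\<forall>v\<in>V. \<exists>t. decision_at A V P \<omega> t v \<noteq> None) \<and>
        dominating_set V E (output_set A V P \<omega>)) \<and>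
     (\<integral>\<omega>. real (card (output_set A V P \<omega>)) \<partial>random_tapes V)
       \<le> (1 + \<epsilon>) * real (domination_number V E))"

end

theory Submission
  imports Defs "HOL-Real_Asymp.Real_Asymp"
begin

text \<open>
  Take a bounded-degree relation \<open>R\<close> on \<open>N\<close> points that joins any two sets of at least \<open>N/4\<close>
  points. In its bipartite double cover replace every edge by two paths of length \<open>3k + 2\<close> with
  \<open>k = \<Theta>(1/\<epsilon>)\<close>, and attach a pendant path to every original vertex. Selecting one whole side of
  the double cover is close to optimal. A path neither of whose end points is selected costs one extra
  vertex, so a dominating set that selects about half of both sides costs \<open>N/2\<close> more.

  The graph has an automorphism \<open>\<sigma>\<close> that exchanges the sides and respects the ports, so every
  algorithm selects \<open>x\<close> and \<open>\<sigma> x\<close> with the same probability. If it stops after \<open>o(log n / \<epsilon>)\<close> rounds,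
  its choices at distant vertices are uncorrelated and each vertex is close to only \<open>n\<^sup>1\<^sup>/\<^sup>2\<close> others;
  hence the numbers of vertices selected on the two sides almost agree by a second moment estimate.
\<close>

section \<open>Joining relations of bounded degree\<close>

text \<open>A weak form of expansion. The threshold \<open>N/4\<close> later leaves a gap of about
  \<open>N/2\<close> between the cost of a balanced dominating set and that of a one-sided
  one.\<close>

definition well_joined :: "nat \<Rightarrow> (nat \<times> nat) set \<Rightarrow> bool" where
  "well_joined N R \<longleftrightarrow> (\<forall>A B. A \<subseteq> {..<N} \<longrightarrow> B \<subseteq> {..<N} \<longrightarrow> N \<le> 4 * card A \<longrightarrow> N \<le> 4 * card B
     \<longrightarrow> R \<inter> A \<times> B \<noteq> {})"

text \<open>A function stands for a choice of \<open>d\<close> targets at every point. Those with no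
  edge from \<open>A\<close> to \<open>B\<close> form a product set: each of the
  \<open>d * card A\<close> choices made in \<open>A\<close> loses \<open>card B\<close>
  options.\<close>

lemma card_avoiding_functions:
  assumes "A \<subseteq> {..<N}" "B \<subseteq> {..<N}"
  shows "card (PiE ({..<N} \<times> {..<d}) (\<lambda>(x, j). if x \<in> A then {..<N} - B else {..<N}))
     = (N - card B) ^ (d * card A) * N ^ (d * (N - card A))"
proof -
  have fin: "finite A" "finite B" using assms finite_subset by auto
  have "card (PiE ({..<N} \<times> {..<d}) (\<lambda>(x, j). if x \<in> A then {..<N} - B else {..<N}))
     = (\<Prod>(x, j)\<in>{..<N} \<times> {..<d}. if x \<in> A then N - card B else N)"
    using assms by (subst card_PiE) (auto simp: card_Diff_subset fin intro!: prod.cong)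
  also have "\<dots> = (\<Prod>x<N. \<Prod>j<d. if x \<in> A then N - card B else N)"
    by (rule prod.cartesian_product[symmetric])
  also have "\<dots> = (\<Prod>x<N. if x \<in> A then (N - card B) ^ d else N ^ d)"
    by (intro prod.cong) auto
  also have "\<dots> = (\<Prod>x\<in>{..<N} \<inter> A. (N - card B) ^ d) * (\<Prod>x\<in>{..<N} \<inter> - A. N ^ d)"
    by (subst prod.If_cases) (auto intro!: arg_cong2[of _ _ _ _ "(*)"] prod.cong)
  also have "{..<N} \<inter> A = A" using assms by auto
  also have "{..<N} \<inter> - A = {..<N} - A" by auto
  also have "(\<Prod>x\<in>A. (N - card B) ^ d) * (\<Prod>x\<in>{..<N} - A. N ^ d)
      = (N - card B) ^ (d * card A) * N ^ (d * (N - card A))"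
    using assms fin by (simp add: card_Diff_subset power_mult)
  finally show ?thesis .
qed

text \<open>At least \<open>11 * N\<close> of the choices each miss a set of density at least 1/8.
  The number 44 is four times 11, the least exponent with \<open>4 * (7/8) ^ 11 < 1\<close>.\<close>

lemma avoiding_functions_bound:
  assumes "A \<subseteq> {..<N}" "B \<subseteq> {..<N}" "N \<le> 4 * card A" "N \<le> 8 * card B" "N > 0"
  shows "real ((N - card B) ^ (44 * card A) * N ^ (44 * (N - card A)))
     \<le> (7/8) ^ (11 * N) * real N ^ (44 * N)"
proof -
  have cA: "card A \<le> N" "card B \<le> N" using card_mono[OF _ assms(1)] card_mono[OF _ assms(2)] by auto
  have "real (N - card B) \<le> 7/8 * real N" using cA assms(4) by simp
  hence "real (N - card B) ^ (44 * card A) \<le> (7/8 * real N) ^ (44 * card A)"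
    by (intro power_mono) auto
  also have "\<dots> = (7/8) ^ (44 * card A) * real N ^ (44 * card A)" by (rule power_mult_distrib)
  also have "\<dots> \<le> (7/8) ^ (11 * N) * real N ^ (44 * card A)"
    using assms(3) by (intro mult_right_mono power_decreasing) auto
  finally have "real ((N - card B) ^ (44 * card A) * N ^ (44 * (N - card A)))
     \<le> (7/8) ^ (11 * N) * real N ^ (44 * card A) * real N ^ (44 * (N - card A))"
    by (auto intro: mult_right_mono)
  also have "\<dots> = (7/8) ^ (11 * N) * real N ^ (44 * card A + 44 * (N - card A))"
    by (simp add: power_add)
  also have "44 * card A + 44 * (N - card A) = 44 * N" using cA by simp
  finally show ?thesis .
qed

text \<open>Union bound over the at most \<open>4 ^ N\<close> pairs \<open>(A, B)\<close>: the bad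
  functions are fewer than all functions. The threshold for \<open>B\<close> is \<open>N/8\<close>
  because targets of large in-degree are discarded afterwards.\<close>

lemma ex_joining_functions:
  assumes "N > 0"
  shows "\<exists>g :: nat \<times> nat \<Rightarrow> nat. (\<forall>x<N. \<forall>j<44. g (x, j) < N) \<and>
     (\<forall>A B. A \<subseteq> {..<N} \<longrightarrow> B \<subseteq> {..<N} \<longrightarrow> N \<le> 4 * card A \<longrightarrow> N \<le> 8 * card B
        \<longrightarrow> (\<exists>x\<in>A. \<exists>j<44. g (x, j) \<in> B))"
proof -
  define F where "F = PiE ({..<N} \<times> {..<44::nat}) (\<lambda>_. {..<N})"
  define Q where "Q = {(A, B). A \<subseteq> {..<N} \<and> B \<subseteq> {..<N} \<and> N \<le> 4 * card A \<and> N \<le> 8 * card B}"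
  define bad where "bad = (\<lambda>(A, B).
    PiE ({..<N} \<times> {..<44::nat}) (\<lambda>(x, j). if x \<in> A then {..<N} - B else {..<N}))"
  have Qsub: "Q \<subseteq> Pow {..<N} \<times> Pow {..<N}" by (auto simp: Q_def)
  have finQ: "finite Q" by (rule finite_subset[OF Qsub]) auto
  have "card Q \<le> card (Pow {..<N} \<times> Pow {..<N})" by (rule card_mono[OF _ Qsub]) auto
  also have "\<dots> = 4 ^ N" by (simp add: card_cartesian_product card_Pow flip: power_mult_distrib)
  finally have cQ: "real (card Q) \<le> 4 ^ N" by (metis of_nat_le_iff of_nat_numeral of_nat_power)
  have cF: "card F = N ^ (44 * N)" unfolding F_def by (subst card_PiE) (auto simp: mult.commute)
  have "real (card (\<Union>q\<in>Q. bad q)) \<le> (\<Sum>q\<in>Q. real (card (bad q)))"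
    using card_UN_le[OF finQ, of bad] by (metis of_nat_le_iff of_nat_sum)
  also have "\<dots> \<le> (\<Sum>q\<in>Q. (7/8) ^ (11 * N) * real N ^ (44 * N))"
  proof (rule sum_mono)
    fix q assume "q \<in> Q"
    then obtain A B where q: "q = (A, B)" "A \<subseteq> {..<N}" "B \<subseteq> {..<N}" "N \<le> 4 * card A" "N \<le> 8 * card B"
      by (auto simp: Q_def)
    show "real (card (bad q)) \<le> (7/8) ^ (11 * N) * real N ^ (44 * N)"
      using avoiding_functions_bound[OF q(2-5) assms] card_avoiding_functions[OF q(2,3), of 44]
      by (simp add: bad_def q(1))
  qed
  also have "\<dots> = real (card Q) * ((7/8) ^ (11 * N) * real N ^ (44 * N))" by simp
  also have "\<dots> \<le> 4 ^ N * ((7/8) ^ (11 * N) * real N ^ (44 * N))"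
    by (rule mult_right_mono[OF cQ]) auto
  also have "\<dots> = (4 * (7/8) ^ 11) ^ N * real N ^ (44 * N)"
    by (simp only: power_mult power_mult_distrib mult.assoc)
  also have "\<dots> < 1 * real N ^ (44 * N)"
  proof (rule mult_strict_right_mono)
    show "(4 * (7/8) ^ 11 :: real) ^ N < 1"
      using assms by (subst power_less_one_iff) (auto simp: power_divide divide_simps)
  qed (use assms in auto)
  also have "\<dots> = real (card F)" by (simp add: cF)
  finally have "card (\<Union>q\<in>Q. bad q) < card F" by simp
  moreover have "finite (\<Union>q\<in>Q. bad q)" using finQ
    by (auto simp: bad_def intro!: finite_PiE)
  ultimately have "\<not> F \<subseteq> (\<Union>q\<in>Q. bad q)" using card_mono leD by blast
  then obtain g where g: "g \<in> F" "\<And>q. q \<in> Q \<Longrightarrow> g \<notin> bad q" by auto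
  show ?thesis
  proof (intro exI[of _ g] conjI allI impI)
    fix x j :: nat assume "x < N" "j < 44"
    thus "g (x, j) < N" using g(1) by (auto simp: F_def)
  next
    fix A B assume AB: "A \<subseteq> {..<N}" "B \<subseteq> {..<N}" "N \<le> 4 * card A" "N \<le> 8 * card B"
    hence "g \<notin> bad (A, B)" by (intro g(2)) (auto simp: Q_def)
    thus "\<exists>x\<in>A. \<exists>j<44. g (x, j) \<in> B"
      using g(1) by (auto simp: bad_def F_def PiE_iff split: if_splits)
  qed
qed

text \<open>The chosen targets give out-degree 44, but some in-degrees may be large. Discarding the
  few heavy targets and symmetrizing leaves degree at most \<open>44 + 352 + 1\<close>.\<close>

lemma ex_well_joined:
  assumes "N > 0"
  shows "\<exists>R. R \<subseteq> {..<N} \<times> {..<N} \<and> sym R \<and> (\<forall>u<N. (u, u) \<in> R) \<and>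
     (\<forall>u. card (R `` {u}) \<le> 400) \<and> well_joined N R"
proof -
  obtain g :: "nat \<times> nat \<Rightarrow> nat" where g: "\<And>x j. x < N \<Longrightarrow> j < 44 \<Longrightarrow> g (x, j) < N"
    "\<And>A B. A \<subseteq> {..<N} \<Longrightarrow> B \<subseteq> {..<N} \<Longrightarrow> N \<le> 4 * card A \<Longrightarrow> N \<le> 8 * card B
        \<Longrightarrow> \<exists>x\<in>A. \<exists>j<44. g (x, j) \<in> B"
    using ex_joining_functions[OF assms] by blast
  define I where "I y = {x \<in> {..<N} \<times> {..<44}. g x = y}" for y
  have finI: "finite (I y)" for y by (auto simp: I_def)
  \<comment> \<open>The average in-degree is 44, so at most one eighth of the points exceed
    \<open>352 = 8 * 44\<close>. A set of \<open>N/4\<close> points thus keeps at least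
    \<open>N/8\<close> of them outside \<open>H\<close>.\<close>
  define H where "H = {y \<in> {..<N}. card (I y) > 352}"
  define F where "F = {(x, y). x < N \<and> (\<exists>j<44. g (x, j) = y) \<and> y \<notin> H}"
  \<comment> \<open>The converse makes the two sides of the double cover interchangeable. The loops
    make the powers of \<open>R\<close> increase on \<open>{..<N}\<close>, so that walks of
    different lengths can be compared.\<close>
  define R where "R = F \<union> F\<inverse> \<union> Id_on {..<N}"
  have heavy: "8 * card H \<le> N"
  proof -
    have "352 * card H = (\<Sum>y\<in>H. 352)" by simp
    also have "\<dots> \<le> (\<Sum>y\<in>H. card (I y))" by (rule sum_mono) (auto simp: H_def)
    also have "\<dots> = card (\<Union>y\<in>H. I y)"
      by (rule card_UN_disjoint[symmetric]) (auto simp: H_def I_def)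
    also have "\<dots> \<le> card ({..<N} \<times> {..<44::nat})" by (rule card_mono) (auto simp: I_def)
    also have "\<dots> = 44 * N" by simp
    finally show ?thesis by simp
  qed
  have Fsub: "F \<subseteq> {..<N} \<times> {..<N}" using g(1) by (auto simp: F_def)
  have out: "card (F `` {u}) \<le> 44" for u
  proof -
    have "F `` {u} \<subseteq> (\<lambda>j. g (u, j)) ` {..<44}" by (auto simp: F_def)
    hence "card (F `` {u}) \<le> card ((\<lambda>j. g (u, j)) ` {..<44})" by (rule card_mono[rotated]) auto
    also have "\<dots> \<le> 44" using card_image_le[of "{..<44::nat}" "\<lambda>j. g (u, j)"] by simp
    finally show ?thesis .
  qed
  have "card (F\<inverse> `` {u}) \<le> 352" for u
  proof (cases "u \<in> {..<N} - H")
    case True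
    have "F\<inverse> `` {u} \<subseteq> fst ` I u" by (force simp: F_def I_def)
    hence "card (F\<inverse> `` {u}) \<le> card (fst ` I u)" by (rule card_mono[rotated]) (auto simp: finI)
    also have "\<dots> \<le> card (I u)" by (rule card_image_le[OF finI])
    also have "\<dots> \<le> 352" using True by (auto simp: H_def)
    finally show ?thesis .
  next
    case False
    hence "F\<inverse> `` {u} = {}" using g(1) by (auto simp: F_def)
    thus ?thesis by simp
  qed
  moreover have "card (Id_on {..<N} `` {u}) \<le> 1" for u
    by (rule order_trans[OF card_mono[of "{u}"]]) auto
  ultimately have deg: "card (R `` {u}) \<le> 400" for u
  proof -
    have "card (R `` {u}) \<le> card (F `` {u}) + card (F\<inverse> `` {u}) + card (Id_on {..<N} `` {u})"
      unfolding R_def Un_Image by (meson add_mono card_Un_le order_trans order_refl)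
    thus ?thesis using out[of u] \<open>card (F\<inverse> `` {u}) \<le> 352\<close> \<open>card (Id_on {..<N} `` {u}) \<le> 1\<close> by simp
  qed
  have "well_joined N R"
    unfolding well_joined_def
  proof (intro allI impI)
    fix A B assume AB: "A \<subseteq> {..<N}" "B \<subseteq> {..<N}" "N \<le> 4 * card A" "N \<le> 4 * card B"
    have finH: "finite H" by (auto simp: H_def)
    have "card B - card H \<le> card (B - H)" by (rule diff_card_le_card_Diff[OF finH])
    hence "N \<le> 8 * card (B - H)" using AB(4) heavy by simp
    with g(2)[of A "B - H"] AB obtain x j where "x \<in> A" "j < 44" "g (x, j) \<in> B - H" by blast
    hence "(x, g (x, j)) \<in> R \<inter> A \<times> B" using AB(1) by (auto simp: R_def F_def)
    thus "R \<inter> A \<times> B \<noteq> {}" by blast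
  qed
  moreover have "sym R" by (auto simp: R_def sym_def)
  moreover have "R \<subseteq> {..<N} \<times> {..<N}" using Fsub by (auto simp: R_def)
  ultimately show ?thesis using deg by (intro exI[of _ R]) (auto simp: R_def)
qed

section \<open>Symmetry and locality of LOCAL algorithms\<close>

fun reach :: "(nat \<Rightarrow> nat list) \<Rightarrow> nat \<Rightarrow> nat \<Rightarrow> nat set" where
  "reach P 0 v = {v}"
| "reach P (Suc t) v = reach P t v \<union> (\<Union>u\<in>set (P v). reach P t u)"

definition port_closed :: "nat set \<Rightarrow> (nat \<Rightarrow> nat list) \<Rightarrow> bool" where
  "port_closed V P \<longleftrightarrow> (\<forall>x\<in>V. set (P x) \<subseteq> V)"

text \<open>A symmetry that respects the order of the ports, so that an anonymous vertex cannot tell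
  whether it sits at \<open>x\<close> or at \<open>\<sigma> x\<close>. Fixed points are allowed; the
  identity is an instance.\<close>

definition port_involution :: "nat set \<Rightarrow> (nat \<Rightarrow> nat list) \<Rightarrow> (nat \<Rightarrow> nat) \<Rightarrow> bool" where
  "port_involution V P \<sigma> \<longleftrightarrow> (\<forall>x\<in>V. \<sigma> x \<in> V \<and> \<sigma> (\<sigma> x) = x \<and> P (\<sigma> x) = map \<sigma> (P x))"

lemma port_involutionD:
  assumes "port_involution V P \<sigma>" "x \<in> V"
  shows "\<sigma> x \<in> V" "\<sigma> (\<sigma> x) = x" "P (\<sigma> x) = map \<sigma> (P x)"
  using assms by (auto simp: port_involution_def)

lemma port_involution_id: "port_involution V P (\<lambda>x. x)"
  by (simp add: port_involution_def)

lemma port_involution_inj: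
  assumes "port_involution V P \<sigma>"
  shows "inj_on \<sigma> V"
  by (metis assms inj_onI port_involutionD(2))

lemma reach_subset:
  assumes "port_closed V P" "v \<in> V"
  shows "reach P t v \<subseteq> V"
  using assms(2)
proof (induction t arbitrary: v)
  case (Suc t)
  thus ?case using assms(1) by (force simp: port_closed_def)
qed auto

lemma image_reach:
  assumes "port_closed V P" "port_involution V P \<sigma>" "v \<in> V"
  shows "\<sigma> ` reach P t v = reach P t (\<sigma> v)"
  using assms(3)
proof (induction t arbitrary: v)
  case (Suc t)
  have "u \<in> V" if "u \<in> set (P v)" for u
    using that assms(1) Suc.prems by (auto simp: port_closed_def)
  hence "\<sigma> ` reach P t u = reach P t (\<sigma> u)" if "u \<in> set (P v)" for u
    using that Suc.IH by blast
  thus ?case using Suc port_involutionD(3)[OF assms(2) Suc.prems]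
    by (simp add: image_Un image_UN)
qed auto

lemma port_to_involution:
  assumes "port_closed V P" "port_involution V P \<sigma>" "u \<in> V" "v \<in> V"
  shows "port_to P (\<sigma> u) (\<sigma> v) = port_to P u v"
proof -
  have "\<sigma> (P u ! j) = \<sigma> v \<longleftrightarrow> P u ! j = v" if "j < length (P u)" for j
  proof -
    have "P u ! j \<in> V" using that assms(1,3) nth_mem by (fastforce simp: port_closed_def)
    thus ?thesis using port_involution_inj[OF assms(2)] assms(4) by (auto simp: inj_on_def)
  qed
  hence "(j < length (P (\<sigma> u)) \<and> P (\<sigma> u) ! j = \<sigma> v) \<longleftrightarrow> (j < length (P u) \<and> P u ! j = v)" for j
    using port_involutionD(3)[OF assms(2,3)] by auto
  thus ?thesis unfolding port_to_def by simp
qed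

text \<open>One induction gives both symmetry and locality: a state depends only on the tapes in its
  ball, and \<open>\<sigma>\<close> carries the whole computation along. Taking
  \<open>\<sigma>\<close> as the identity yields pure locality.\<close>

lemma state_at_transport:
  assumes "port_closed V P" "port_involution V P \<sigma>" "v \<in> V"
    and "\<And>y. y \<in> reach P t v \<Longrightarrow> \<omega>' y = \<omega> (\<sigma> y)"
  shows "state_at A V P \<omega>' t v = state_at A V P \<omega> t (\<sigma> v)"
  using assms(3,4)
proof (induction t arbitrary: v)
  case 0
  thus ?case using port_involutionD(3)[OF assms(2) 0(1)] by simp
next
  case (Suc t)
  have nb: "u \<in> V" if "u \<in> set (P v)" for u
    using that assms(1) Suc.prems by (auto simp: port_closed_def)
  have "state_at A V P \<omega>' t v = state_at A V P \<omega> t (\<sigma> v)"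
    using Suc.prems by (intro Suc.IH) auto
  moreover have "state_at A V P \<omega>' t u = state_at A V P \<omega> t (\<sigma> u)" if "u \<in> set (P v)" for u
    using Suc.prems nb that by (intro Suc.IH) auto
  moreover have "port_to P (\<sigma> u) (\<sigma> v) = port_to P u v" if "u \<in> set (P v)" for u
    using port_to_involution[OF assms(1,2)] nb that Suc.prems by blast
  ultimately show ?case using port_involutionD(3)[OF assms(2) Suc.prems(1)]
    by (auto intro!: arg_cong2[of _ _ _ _ "receive A"])
qed

lemma port_closed_network:
  assumes "network V E P"
  shows "port_closed V P"
proof -
  have "u \<in> V" if "{u, v} \<in> E" for u v
    using assms that by (fastforce simp: network_def simple_graph_def doubleton_eq_iff)
  thus ?thesis using assms
    by (auto simp: port_closed_def network_def port_numbering_def neighbours_def)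
qed

section \<open>Independent random tapes and the bias between mirror vertices\<close>

lemma prob_space_fair_coin_flips: "prob_space fair_coin_flips"
  unfolding fair_coin_flips_def by (intro prob_space_PiM measure_pmf.prob_space_axioms)

lemma prob_space_random_tapes: "prob_space (random_tapes V)"
  unfolding random_tapes_def by (intro prob_space_PiM prob_space_fair_coin_flips)

text \<open>The tapes are independent and identically distributed, so permuting them among the
  vertices preserves the product measure.\<close>

lemma integral_random_tapes_permute:
  fixes f :: "(nat \<Rightarrow> bits) \<Rightarrow> real"
  assumes "inj_on \<tau> V" "\<tau> \<in> V \<rightarrow> V" "f \<in> borel_measurable (random_tapes V)"
  shows "(\<integral>\<omega>. f \<omega> \<partial>random_tapes V) = (\<integral>\<omega>. f (\<lambda>x\<in>V. \<omega> (\<tau> x)) \<partial>random_tapes V)"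
proof -
  let ?h = "\<lambda>\<omega>. \<lambda>x\<in>V. \<omega> (\<tau> x)"
  have meas: "?h \<in> measurable (random_tapes V) (random_tapes V)"
    unfolding random_tapes_def using assms(2)
    by (intro measurable_restrict measurable_component_singleton) auto
  have "distr (random_tapes V) (random_tapes V) ?h = random_tapes V"
    unfolding random_tapes_def using assms(1,2) prob_space_fair_coin_flips
    by (intro distr_PiM_reindex) auto
  thus ?thesis using integral_distr[OF meas assms(3)] by simp
qed

text \<open>The decision is read at one fixed round; it agrees with membership in the final output
  once every vertex has decided by then.\<close>

definition joins :: "local_alg \<Rightarrow> nat set \<Rightarrow> (nat \<Rightarrow> nat list) \<Rightarrow> nat \<Rightarrow> nat \<Rightarrow> (nat \<Rightarrow> bits) \<Rightarrow> real" where
  "joins A V P t x \<omega> = of_bool (decision_at A V P \<omega> t x = Some True)"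

lemma joins_range: "0 \<le> joins A V P t x \<omega>" "joins A V P t x \<omega> \<le> 1"
  by (auto simp: joins_def)

lemma joins_measurable:
  assumes "randomized_local_algorithm A" "network V E P" "x \<in> V"
  shows "joins A V P t x \<in> borel_measurable (random_tapes V)"
proof -
  have "(\<lambda>\<omega>. decision_at A V P \<omega> t x) \<in> measurable (random_tapes V) (count_space UNIV)"
    using assms unfolding randomized_local_algorithm_def by blast
  from measurable_compose[OF this, of "\<lambda>d. of_bool (d = Some True) :: real" borel]
  show ?thesis unfolding joins_def by simp
qed

locale symmetric_network =
  fixes A :: local_alg and V E P \<sigma> and T :: nat
  assumes alg: "randomized_local_algorithm A"
    and net: "network V E P"
    and inv: "port_involution V P \<sigma>"
begin

text \<open>Uniting both balls makes the set invariant under \<open>\<sigma>\<close> for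
  \<open>x\<close> in \<open>V\<close>, so tapes can be exchanged within it. It contains every tape
  on which \<open>bias x\<close> depends.\<close>

definition zone :: "nat \<Rightarrow> nat set" where
  "zone x = reach P T x \<union> reach P T (\<sigma> x)"

text \<open>Summed over one side of the double cover, this is the difference between the numbers of
  vertices selected on the two sides.\<close>

definition bias :: "nat \<Rightarrow> (nat \<Rightarrow> bits) \<Rightarrow> real" where
  "bias x \<omega> = joins A V P T x \<omega> - joins A V P T (\<sigma> x) \<omega>"

lemma bias_measurable:
  assumes "x \<in> V"
  shows "bias x \<in> borel_measurable (random_tapes V)"
  unfolding bias_def[abs_def] using joins_measurable[OF alg net] assms port_involutionD(1)[OF inv]
  by (intro borel_measurable_diff) auto

lemma abs_bias: "\<bar>bias x \<omega>\<bar> \<le> 1"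
  using joins_range[of A V P T x \<omega>] joins_range[of A V P T "\<sigma> x" \<omega>] by (simp add: bias_def)

lemma integrable_bias_prod:
  assumes "x \<in> V" "y \<in> V"
  shows "integrable (random_tapes V) (\<lambda>\<omega>. bias x \<omega> * bias y \<omega>)"
proof -
  interpret prob_space "random_tapes V" by (rule prob_space_random_tapes)
  show ?thesis
  proof (rule integrable_const_bound[of _ 1])
    show "AE \<omega> in random_tapes V. norm (bias x \<omega> * bias y \<omega>) \<le> 1"
      using abs_bias by (auto simp: abs_mult intro!: mult_le_one)
  qed (use assms bias_measurable in auto)
qed

text \<open>
  Swapping the tapes of \<open>x\<close>'s zone along \<open>\<sigma>\<close> preserves the measure, negates the bias of \<open>x\<close> and
  leaves the bias of \<open>y\<close> unchanged. This replaces both the symmetry and the independence argument.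
\<close>

lemma bias_uncorrelated:
  assumes x: "x \<in> V" and y: "y \<in> V" and disj: "zone x \<inter> zone y = {}"
  shows "(\<integral>\<omega>. bias x \<omega> * bias y \<omega> \<partial>random_tapes V) = 0"
proof -
  note closed = port_closed_network[OF net]
  define \<tau> where "\<tau> z = (if z \<in> zone x then \<sigma> z else z)" for z
  have sub: "zone z \<subseteq> V" if "z \<in> V" for z
    using reach_subset[OF closed] port_involutionD(1)[OF inv] that by (auto simp: zone_def)
  have "\<sigma> ` zone x = zone x"
    using image_reach[OF closed inv] port_involutionD(1,2)[OF inv] x
    by (auto simp: zone_def image_Un)
  \<comment> \<open>Invariance of the zone is what makes \<open>\<tau>\<close>, although defined by
    cases, an involution.\<close>
  hence \<tau>zone: "\<tau> z \<in> zone x \<longleftrightarrow> z \<in> zone x" for z by (auto simp: \<tau>_def)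
  have \<tau>\<tau>: "\<tau> (\<tau> z) = z" if "z \<in> V" for z
  proof (cases "z \<in> zone x")
    case True
    thus ?thesis using \<tau>zone[of z] that port_involutionD(2)[OF inv] by (simp add: \<tau>_def)
  qed (simp add: \<tau>_def)
  have \<tau>V: "\<tau> \<in> V \<rightarrow> V" using port_involutionD(1)[OF inv] by (auto simp: \<tau>_def)
  have inj: "inj_on \<tau> V" by (metis \<tau>\<tau> inj_onI)
  let ?h = "\<lambda>\<omega>. \<lambda>z\<in>V. \<omega> (\<tau> z)"
  have swap: "joins A V P T z (?h \<omega>) = joins A V P T (\<sigma> z) \<omega>"
    if "z \<in> V" "reach P T z \<subseteq> zone x" for z \<omega>
  proof -
    have "state_at A V P (?h \<omega>) T z = state_at A V P \<omega> T (\<sigma> z)"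
      using that sub[OF x] by (intro state_at_transport[OF closed inv]) (auto simp: \<tau>_def)
    thus ?thesis by (simp add: joins_def decision_at_def)
  qed
  \<comment> \<open>Disjointness enters here: \<open>\<tau>\<close> is the identity on the zone of
    \<open>y\<close>.\<close>
  have keep: "joins A V P T z (?h \<omega>) = joins A V P T z \<omega>"
    if "z \<in> V" "reach P T z \<subseteq> zone y" for z \<omega>
  proof -
    have "state_at A V P (?h \<omega>) T z = state_at A V P \<omega> T z"
      using that sub[OF y] disj
      by (intro state_at_transport[OF closed port_involution_id]) (auto simp: \<tau>_def)
    thus ?thesis by (simp add: joins_def decision_at_def)
  qed
  have neg: "bias x (?h \<omega>) * bias y (?h \<omega>) = - (bias x \<omega> * bias y \<omega>)" for \<omega>
  proof -
    have "bias x (?h \<omega>) = - bias x \<omega>"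
      using swap[of x] swap[of "\<sigma> x"] x port_involutionD(1,2)[OF inv x]
      by (simp add: bias_def zone_def)
    moreover have "bias y (?h \<omega>) = bias y \<omega>"
      using keep[of y] keep[of "\<sigma> y"] y port_involutionD(1)[OF inv y]
      by (simp add: bias_def zone_def)
    ultimately show ?thesis by simp
  qed
  have "(\<integral>\<omega>. bias x \<omega> * bias y \<omega> \<partial>random_tapes V)
      = (\<integral>\<omega>. bias x (?h \<omega>) * bias y (?h \<omega>) \<partial>random_tapes V)"
    using x y bias_measurable by (intro integral_random_tapes_permute[OF inj \<tau>V]) auto
  thus ?thesis by (simp add: neg)
qed

text \<open>In the expanded square, pairs with disjoint zones vanish and every other pair
  contributes at most 1.\<close>

lemma second_moment_bias:
  assumes "X \<subseteq> V" "finite X"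
  shows "integrable (random_tapes V) (\<lambda>\<omega>. (\<Sum>x\<in>X. bias x \<omega>)\<^sup>2)"
    and "(\<integral>\<omega>. (\<Sum>x\<in>X. bias x \<omega>)\<^sup>2 \<partial>random_tapes V)
      \<le> (\<Sum>x\<in>X. real (card {y \<in> X. zone x \<inter> zone y \<noteq> {}}))"
proof -
  interpret prob_space "random_tapes V" by (rule prob_space_random_tapes)
  have sq: "(\<Sum>x\<in>X. bias x \<omega>)\<^sup>2 = (\<Sum>x\<in>X. \<Sum>y\<in>X. bias x \<omega> * bias y \<omega>)" for \<omega>
    unfolding power2_eq_square by (rule sum_product)
  show "integrable (random_tapes V) (\<lambda>\<omega>. (\<Sum>x\<in>X. bias x \<omega>)\<^sup>2)"
    unfolding sq using assms(1) by (intro Bochner_Integration.integrable_sum integrable_bias_prod) auto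
  have "(\<integral>\<omega>. (\<Sum>x\<in>X. bias x \<omega>)\<^sup>2 \<partial>random_tapes V)
      = (\<Sum>x\<in>X. \<Sum>y\<in>X. \<integral>\<omega>. bias x \<omega> * bias y \<omega> \<partial>random_tapes V)"
  proof -
    have int: "integrable (random_tapes V) (\<lambda>\<omega>. bias x \<omega> * bias y \<omega>)" if "x \<in> X" "y \<in> X" for x y
      using that assms(1) integrable_bias_prod by blast
    have "(\<integral>\<omega>. (\<Sum>y\<in>X. bias x \<omega> * bias y \<omega>) \<partial>random_tapes V)
      = (\<Sum>y\<in>X. \<integral>\<omega>. bias x \<omega> * bias y \<omega> \<partial>random_tapes V)" if "x \<in> X" for x
      using that int by (intro Bochner_Integration.integral_sum) auto
    moreover have "(\<integral>\<omega>. (\<Sum>x\<in>X. \<Sum>y\<in>X. bias x \<omega> * bias y \<omega>) \<partial>random_tapes V)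
      = (\<Sum>x\<in>X. \<integral>\<omega>. (\<Sum>y\<in>X. bias x \<omega> * bias y \<omega>) \<partial>random_tapes V)"
      using int by (intro Bochner_Integration.integral_sum Bochner_Integration.integrable_sum) auto
    ultimately show ?thesis unfolding sq by simp
  qed
  also have "\<dots> \<le> (\<Sum>x\<in>X. \<Sum>y\<in>X. of_bool (zone x \<inter> zone y \<noteq> {}))"
  proof (intro sum_mono)
    fix x y assume "x \<in> X" "y \<in> X"
    hence xy: "x \<in> V" "y \<in> V" using assms(1) by auto
    show "(\<integral>\<omega>. bias x \<omega> * bias y \<omega> \<partial>random_tapes V) \<le> of_bool (zone x \<inter> zone y \<noteq> {})"
    proof (cases "zone x \<inter> zone y = {}")
      case False
      have "bias x \<omega> * bias y \<omega> \<le> 1" for \<omega>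
        using abs_bias[of x \<omega>] abs_bias[of y \<omega>]
        by (metis abs_ge_self abs_ge_zero abs_mult mult_le_one order_trans)
      hence "(\<integral>\<omega>. bias x \<omega> * bias y \<omega> \<partial>random_tapes V) \<le> 1"
        using integrable_bias_prod[OF xy] by (intro integral_le_const) auto
      thus ?thesis using False by simp
    qed (simp add: bias_uncorrelated[OF xy])
  qed
  also have "\<dots> = (\<Sum>x\<in>X. real (card {y \<in> X. zone x \<inter> zone y \<noteq> {}}))"
    using assms(2) by (intro sum.cong refl) (simp add: Int_def sum.If_cases of_bool_def)
  finally show "(\<integral>\<omega>. (\<Sum>x\<in>X. bias x \<omega>)\<^sup>2 \<partial>random_tapes V)
      \<le> (\<Sum>x\<in>X. real (card {y \<in> X. zone x \<inter> zone y \<noteq> {}}))" .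
qed

end

section \<open>Final outputs: persistence and measurability\<close>

lemma decision_at_persist:
  assumes "randomized_local_algorithm A" "decision_at A V P \<omega> t v = Some b" "t \<le> s"
  shows "decision_at A V P \<omega> s v = Some b"
  using assms(3)
proof (induction s rule: dec_induct)
  case (step s)
  thus ?case using assms(1) by (simp add: decision_at_def randomized_local_algorithm_def)
qed (use assms(2) in simp)

text \<open>Decisions are irrevocable, so one found at any round \<open>t\<close> can be compared
  with the one at round \<open>T\<close> by looking at round \<open>max t T\<close>.\<close>

lemma output_set_decided:
  assumes "randomized_local_algorithm A" "\<forall>v\<in>V. decision_at A V P \<omega> T v \<noteq> None"
  shows "output_set A V P \<omega> = {v \<in> V. decision_at A V P \<omega> T v = Some True}"
proof -
  have "decision_at A V P \<omega> T v = Some True" if v: "v \<in> V" "decision_at A V P \<omega> t v = Some True" for v t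
  proof -
    obtain b where b: "decision_at A V P \<omega> T v = Some b" using assms(2) v by auto
    have "decision_at A V P \<omega> (max t T) v = Some b" "decision_at A V P \<omega> (max t T) v = Some True"
      by (rule decision_at_persist[OF assms(1) b max.cobounded2],
          rule decision_at_persist[OF assms(1) v(2) max.cobounded1])
    thus ?thesis using b by simp
  qed
  thus ?thesis by (auto simp: output_set_def)
qed

text \<open>The output refers to all rounds, so membership of a vertex is a countable union of
  measurable events.\<close>

lemma card_output_set_measurable:
  assumes "randomized_local_algorithm A" "network V E P"
  shows "(\<lambda>\<omega>. real (card (output_set A V P \<omega>))) \<in> borel_measurable (random_tapes V)"
proof -
  have fin: "finite V" using assms(2) by (simp add: network_def simple_graph_def)
  have "Measurable.pred (random_tapes V) (\<lambda>\<omega>. decision_at A V P \<omega> t x = Some True)" if "x \<in> V" for x t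
  proof -
    have "(\<lambda>\<omega>. decision_at A V P \<omega> t x) \<in> measurable (random_tapes V) (count_space UNIV)"
      using assms that unfolding randomized_local_algorithm_def by blast
    thus ?thesis by (rule measurable_compose) simp
  qed
  hence "Measurable.pred (random_tapes V) (\<lambda>\<omega>. \<exists>t. decision_at A V P \<omega> t x = Some True)" if "x \<in> V" for x
    using that by (intro pred_intros_countable) auto
  hence "(\<lambda>\<omega>. \<Sum>x\<in>V. of_bool (\<exists>t. decision_at A V P \<omega> t x = Some True) :: real)
     \<in> borel_measurable (random_tapes V)"
    by (intro borel_measurable_sum) (simp add: of_bool_def)
  moreover have "real (card (output_set A V P \<omega>))
      = (\<Sum>x\<in>V. of_bool (\<exists>t. decision_at A V P \<omega> t x = Some True))" for \<omega>
    using fin by (simp add: output_set_def Int_def sum.If_cases of_bool_def)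
  ultimately show ?thesis by simp
qed

section \<open>The subdivided double cover\<close>

text \<open>Allows a graph to be given by port lists on a datatype; \<open>to_nat\<close> moves it
  to natural numbers. Closure and symmetry of the lists are what makes them a simple graph.\<close>

lemma network_of_ports:
  fixes VV :: "'v::countable set" and ports :: "'v \<Rightarrow> 'v list"
  assumes fin: "finite VV"
    and ports: "\<And>x. x \<in> VV \<Longrightarrow> distinct (ports x)" "\<And>x. x \<in> VV \<Longrightarrow> set (ports x) \<subseteq> VV - {x}"
      "\<And>x y. x \<in> VV \<Longrightarrow> y \<in> set (ports x) \<Longrightarrow> x \<in> set (ports y)"
  defines "E \<equiv> {{to_nat x, to_nat y} |x y. x \<in> VV \<and> y \<in> set (ports x)}"
  shows "network (to_nat ` VV) E (\<lambda>n. map to_nat (ports (from_nat n)))"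
    and "\<And>x. x \<in> VV \<Longrightarrow> neighbours E (to_nat x) = to_nat ` set (ports x)"
proof -
  show nb: "neighbours E (to_nat x) = to_nat ` set (ports x)" if "x \<in> VV" for x
  proof
    show "neighbours E (to_nat x) \<subseteq> to_nat ` set (ports x)"
    proof
      fix n assume "n \<in> neighbours E (to_nat x)"
      then obtain y z where "{n, to_nat x} = {to_nat y, to_nat z}" "y \<in> VV" "z \<in> set (ports y)"
        by (auto simp: neighbours_def E_def)
      thus "n \<in> to_nat ` set (ports x)" using ports(3)[of y z] by (auto simp: doubleton_eq_iff)
    qed
    show "to_nat ` set (ports x) \<subseteq> neighbours E (to_nat x)"
      using that by (fastforce simp: neighbours_def E_def insert_commute)
  qed
  have "simple_graph (to_nat ` VV) E" unfolding simple_graph_def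
  proof (intro conjI ballI)
    fix e assume "e \<in> E"
    then obtain x y where "e = {to_nat x, to_nat y}" "x \<in> VV" "y \<in> set (ports x)"
      by (auto simp: E_def)
    moreover have "y \<in> VV" "x \<noteq> y" using calculation ports(2) by auto
    ultimately show "\<exists>u\<in>to_nat ` VV. \<exists>v\<in>to_nat ` VV. u \<noteq> v \<and> e = {u, v}" by auto
  qed (simp add: fin)
  moreover have "port_numbering (to_nat ` VV) E (\<lambda>n. map to_nat (ports (from_nat n)))"
    using nb ports(1) by (auto simp: port_numbering_def distinct_map)
  ultimately show "network (to_nat ` VV) E (\<lambda>n. map to_nat (ports (from_nat n)))"
    by (simp add: network_def)
qed

section \<open>Dominating the inner vertices of a path\<close>

lemma card_thirds_ge:
  fixes Q :: "nat set"
  assumes "finite Q" "\<And>i. i < k \<Longrightarrow> \<exists>q\<in>Q. (q - a) div 3 = i"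
  shows "k \<le> card Q"
proof -
  have "{..<k} \<subseteq> (\<lambda>q. (q - a) div 3) ` Q" using assms(2) by force
  hence "card {..<k} \<le> card ((\<lambda>q. (q - a) div 3) ` Q)"
    using assms(1) by (intro card_mono) auto
  also have "\<dots> \<le> card Q" by (rule card_image_le[OF assms(1)])
  finally show ?thesis by simp
qed

text \<open>Disjoint closed neighbourhoods must each meet \<open>Q\<close>. Here \<open>a\<close>
  and \<open>b\<close> say whether the end points are selected. The length \<open>3 * k + 1\<close>
  is such that one selected end point lowers the bound from \<open>k + 1\<close> to
  \<open>k\<close>, and a second one does not lower it further.\<close>

lemma path_domination:
  fixes Q :: "nat set"
  assumes Q: "Q \<subseteq> {1..3 * k + 1}"
    and dom: "\<And>p. 1 \<le> p \<Longrightarrow> p \<le> 3 * k + 1 \<Longrightarrow>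
       p \<in> Q \<or> p - 1 \<in> Q \<or> p + 1 \<in> Q \<or> (p = 1 \<and> a) \<or> (p = 3 * k + 1 \<and> b)"
  shows "k + of_bool (\<not> a \<and> \<not> b) \<le> card Q"
proof -
  have fin: "finite Q" using Q finite_subset by blast
  show ?thesis
  proof (cases "a \<or> b")
    case False
    have "k + 1 \<le> card Q"
    \<comment> \<open>Neighbourhoods of the positions \<open>1, 4, ..., 3 * k + 1\<close>; neither
      end point helps the outermost two.\<close>
    proof (rule card_thirds_ge[OF fin, where a = 0])
      fix i assume "i < k + 1"
      with dom[of "3 * i + 1"] False have "3 * i + 1 \<in> Q \<or> 3 * i \<in> Q \<or> 3 * i + 2 \<in> Q" by auto
      thus "\<exists>q\<in>Q. (q - 0) div 3 = i" by force
    qed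
    thus ?thesis using False by simp
  next
    case True
    have "k \<le> card Q"
    \<comment> \<open>Neighbourhoods of the positions \<open>2, 5, ..., 3 * k - 1\<close>, which the
      end points cannot dominate.\<close>
    proof (rule card_thirds_ge[OF fin, where a = 1])
      fix i assume "i < k"
      with dom[of "3 * i + 2"] have "3 * i + 2 \<in> Q \<or> 3 * i + 1 \<in> Q \<or> 3 * i + 3 \<in> Q"
        by (auto simp: numeral_3_eq_3)
      moreover have "(3 * i + 2 - 1) div 3 = i" "(3 * i + 1 - 1) div 3 = i" "(3 * i + 3 - 1) div 3 = i"
        by auto
      ultimately show "\<exists>q\<in>Q. (q - 1) div 3 = i" by blast
    qed
    thus ?thesis using True by auto
  qed
qed

datatype vertex = Orig nat bool | Hook nat bool | Leaf nat bool | Path nat nat bool nat | Star nat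

instance vertex :: countable by countable_datatype

text \<open>
  \<open>Orig u i\<close> are the vertices of the bipartite double cover of \<open>R\<close>, each with a pendant path
  \<open>Hook u i\<close>, \<open>Leaf u i\<close>. Each edge \<open>(u, v) \<in> R\<close> becomes two parallel paths (selected by a
  Boolean) from \<open>Orig u False\<close> to \<open>Orig v True\<close> with \<open>3k + 1\<close> inner vertices. A star of size \<open>r\<close>
  pads the graph to any desired number of vertices.
\<close>

locale subdivided_cover =
  fixes N k r :: nat and R :: "(nat \<times> nat) set"
  assumes R: "R \<subseteq> {..<N} \<times> {..<N}" "sym R" "\<And>u. u < N \<Longrightarrow> (u, u) \<in> R"
    and r: "r > 0"
begin

definition vertices :: "vertex set" where
  "vertices = case_prod Orig ` ({..<N} \<times> UNIV) \<union> case_prod Hook ` ({..<N} \<times> UNIV)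
     \<union> case_prod Leaf ` ({..<N} \<times> UNIV)
     \<union> (\<lambda>(((u, v), c), p). Path u v c p) ` ((R \<times> UNIV) \<times> {1..3 * k + 1}) \<union> Star ` {..<r}"

lemma mem_vertices [simp]:
  "Orig u i \<in> vertices \<longleftrightarrow> u < N" "Hook u i \<in> vertices \<longleftrightarrow> u < N" "Leaf u i \<in> vertices \<longleftrightarrow> u < N"
  "Path u v c p \<in> vertices \<longleftrightarrow> (u, v) \<in> R \<and> 1 \<le> p \<and> p \<le> 3 * k + 1" "Star j \<in> vertices \<longleftrightarrow> j < r"
proof -
  show "Path u v c p \<in> vertices \<longleftrightarrow> (u, v) \<in> R \<and> 1 \<le> p \<and> p \<le> 3 * k + 1"
  proof
    assume "(u, v) \<in> R \<and> 1 \<le> p \<and> p \<le> 3 * k + 1"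
    hence "(((u, v), c), p) \<in> (R \<times> UNIV) \<times> {1..3 * k + 1}" by auto
    from imageI[OF this, of "\<lambda>(((u, v), c), p). Path u v c p"]
    show "Path u v c p \<in> vertices" unfolding vertices_def by simp
  qed (auto simp: vertices_def)
qed (auto simp: vertices_def image_iff)

lemma finite_R: "finite R"
  using R(1) finite_subset by blast

lemma finite_vertices: "finite vertices"
  using finite_R by (auto simp: vertices_def)

lemma card_vertices: "card vertices = 6 * N + 2 * card R * (3 * k + 1) + r"
proof -
  have "card (case_prod C ` ({..<N} \<times> (UNIV :: bool set))) = 2 * N"
    if "inj (case_prod C)" for C :: "nat \<Rightarrow> bool \<Rightarrow> vertex"
    using that by (subst card_image) (auto intro: inj_on_subset simp: card_cartesian_product)
  moreover have "inj (case_prod Orig)" "inj (case_prod Hook)" "inj (case_prod Leaf)" "inj Star"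
    by (auto simp: inj_def)
  moreover have "card ((\<lambda>(((u, v), c), p). Path u v c p) ` ((R \<times> UNIV) \<times> {1..3 * k + 1}))
      = 2 * card R * (3 * k + 1)"
    by (subst card_image) (auto simp: inj_on_def card_cartesian_product)
  ultimately show ?thesis
    unfolding vertices_def using finite_R
    by (subst card_Un_disjoint, auto)+ (auto simp: card_image inj_on_def)
qed

text \<open>Positions on the whole path including its end points, so that the ports of inner
  vertices need no special cases.\<close>

definition path_pos :: "nat \<Rightarrow> nat \<Rightarrow> bool \<Rightarrow> nat \<Rightarrow> vertex" where
  "path_pos u v c p = (if p = 0 then Orig u False else if p = 3 * k + 2 then Orig v True
     else Path u v c p)"

text \<open>One order of the incident paths, shared by both sides, so that \<open>swap\<close>
  matches the ports of \<open>Orig u False\<close> and \<open>Orig u True\<close>.\<close>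

definition incident :: "nat \<Rightarrow> (nat \<times> bool) list" where
  "incident u = List.product (sorted_list_of_set (R `` {u})) [False, True]"

text \<open>The Boolean orients a path: the first port of an inner vertex leads towards
  \<open>Orig u False\<close> if \<open>c\<close> holds and towards \<open>Orig v True\<close>
  otherwise. Reversing the path and flipping \<open>c\<close> together preserve the ports; for a
  loop \<open>(u, u)\<close> this exchanges its two copies.\<close>

fun ports :: "vertex \<Rightarrow> vertex list" where
  "ports (Orig u False) = Hook u False # map (\<lambda>(v, c). Path u v c 1) (incident u)"
| "ports (Orig u True) = Hook u True # map (\<lambda>(v, c). Path v u (\<not> c) (3 * k + 1)) (incident u)"
| "ports (Hook u i) = [Orig u i, Leaf u i]"
| "ports (Leaf u i) = [Hook u i]"
| "ports (Path u v c p) = (if c then [path_pos u v c (p - 1), path_pos u v c (p + 1)]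
     else [path_pos u v c (p + 1), path_pos u v c (p - 1)])"
| "ports (Star j) = (if j = 0 then map Star [1..<r] else [Star 0])"

text \<open>The deck transformation of the double cover, extended to the added vertices. A path of
  \<open>(u, v)\<close> goes to a reversed path of \<open>(v, u)\<close>, hence the position
  \<open>3 * k + 2 - p\<close>.\<close>

fun swap :: "vertex \<Rightarrow> vertex" where
  "swap (Orig u i) = Orig u (\<not> i)"
| "swap (Hook u i) = Hook u (\<not> i)"
| "swap (Leaf u i) = Leaf u (\<not> i)"
| "swap (Path u v c p) = Path v u (\<not> c) (3 * k + 2 - p)"
| "swap (Star j) = Star j"

lemma finite_R_image: "finite (R `` {u})"
  by (rule finite_subset[of _ "{..<N}"]) (use R(1) in auto)

lemma set_incident [simp]: "set (incident u) = (R `` {u}) \<times> UNIV"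
  using finite_R_image by (auto simp: incident_def UNIV_bool)

lemma R_sym: "(u, v) \<in> R \<longleftrightarrow> (v, u) \<in> R"
  using R(2) by (auto simp: sym_def)

lemma R_less: "(u, v) \<in> R \<Longrightarrow> u < N \<and> v < N"
  using R(1) by auto

lemma distinct_incident: "distinct (incident u)"
  unfolding incident_def by (intro distinct_product) (auto simp: finite_R_image)

lemma distinct_ports: "distinct (ports x)" if "x \<in> vertices"
proof (cases x rule: ports.cases)
  case (1 u)
  thus ?thesis using distinct_incident[of u]
    by (auto simp: distinct_map inj_on_def)
next
  case (2 u)
  thus ?thesis using distinct_incident[of u]
    by (auto simp: distinct_map inj_on_def)
next
  case (6 j)
  thus ?thesis by (auto simp: distinct_map inj_on_def)
qed (use that in \<open>auto simp: path_pos_def\<close>)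

lemma ports_closed: "set (ports x) \<subseteq> vertices - {x}" if "x \<in> vertices"
  by (cases x rule: ports.cases) (use that R_less R_sym r in \<open>auto simp: path_pos_def\<close>)

lemma path_pos_adjacent:
  assumes "(u, v) \<in> R" "q \<le> 3 * k + 1"
  shows "path_pos u v c q \<in> set (ports (path_pos u v c (q + 1)))"
    and "path_pos u v c (q + 1) \<in> set (ports (path_pos u v c q))"
proof -
  have first: "Path u v c 1 \<in> set (ports (Orig u False))" using assms(1) by auto
  have "(u, \<not> c) \<in> set (incident v)" using assms(1) R_sym by auto
  from imageI[OF this, of "\<lambda>(w, c). Path w v (\<not> c) (3 * k + 1)"]
  have last: "Path u v c (3 * k + 1) \<in> set (ports (Orig v True))" by simp
  consider "q = 0" | "q \<noteq> 0" "q = 3 * k + 1" | "q \<noteq> 0" "q < 3 * k + 1" using assms(2) by linarith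
  thus "path_pos u v c q \<in> set (ports (path_pos u v c (q + 1)))"
    by cases (use last in \<open>simp_all add: path_pos_def\<close>)
  from \<open>q \<le> 3 * k + 1\<close> consider "q = 0" | "q \<noteq> 0" by blast
  thus "path_pos u v c (q + 1) \<in> set (ports (path_pos u v c q))"
    by cases (use first assms(2) in \<open>simp_all add: path_pos_def\<close>)
qed

lemma ports_sym: "x \<in> set (ports y)" if "x \<in> vertices" "y \<in> set (ports x)"
proof (cases x rule: ports.cases)
  case (1 u)
  thus ?thesis using that by (auto simp: path_pos_def)
next
  case (2 u)
  thus ?thesis using that by (auto simp: path_pos_def)
next
  case (3 u i)
  thus ?thesis using that by (cases i) auto
next
  case (5 u v c p)
  hence p: "(u, v) \<in> R" "1 \<le> p" "p \<le> 3 * k + 1" using that by auto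
  hence x: "x = path_pos u v c p" using 5 by (simp add: path_pos_def)
  have "y = path_pos u v c (p - 1) \<or> y = path_pos u v c (p + 1)"
    using that(2) 5 by (auto split: if_splits)
  thus ?thesis using path_pos_adjacent[OF p(1), of "p - 1"] path_pos_adjacent[OF p(1), of p] p x
    by auto
qed (use that in \<open>auto split: if_splits\<close>)

lemma swap_swap: "swap x \<in> vertices \<and> swap (swap x) = x" if "x \<in> vertices"
  using that R_sym by (cases x) auto

lemma ports_swap: "ports (swap x) = map swap (ports x)" if "x \<in> vertices"
proof (cases x rule: ports.cases)
  case (5 u v c p)
  thus ?thesis using that by (auto simp: path_pos_def)
qed (use that in \<open>auto simp: o_def case_prod_unfold\<close>)

definition V :: "nat set" where "V = to_nat ` vertices"
definition E :: "nat set set" where "E = {{to_nat x, to_nat y} |x y. x \<in> vertices \<and> y \<in> set (ports x)}"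
definition P :: "nat \<Rightarrow> nat list" where "P n = map to_nat (ports (from_nat n))"
definition \<sigma> :: "nat \<Rightarrow> nat" where "\<sigma> n = to_nat (swap (from_nat n))"

lemma network: "network V E P"
  unfolding V_def E_def P_def[abs_def]
  by (rule network_of_ports(1)[OF finite_vertices distinct_ports ports_closed ports_sym])

lemma neighbours_to_nat: "x \<in> vertices \<Longrightarrow> neighbours E (to_nat x) = to_nat ` set (ports x)"
  unfolding E_def
  by (rule network_of_ports(2)[OF finite_vertices distinct_ports ports_closed ports_sym])

lemma involution: "port_involution V P \<sigma>"
  unfolding port_involution_def V_def P_def \<sigma>_def using swap_swap ports_swap by auto

lemma card_V: "card V = 6 * N + 2 * card R * (3 * k + 1) + r"
  unfolding V_def by (subst card_image) (auto simp: card_vertices)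

section \<open>Dominating sets of the subdivided cover\<close>

definition dominates :: "vertex set \<Rightarrow> bool" where
  "dominates S \<longleftrightarrow> S \<subseteq> vertices \<and> (\<forall>x\<in>vertices. x \<in> S \<or> set (ports x) \<inter> S \<noteq> {})"

lemma dominating_set_image_iff:
  "S \<subseteq> vertices \<Longrightarrow> dominating_set V E (to_nat ` S) \<longleftrightarrow> dominates S"
  by (auto simp: dominating_set_def dominates_def V_def neighbours_to_nat inj_image_mem_iff
      simp flip: image_Int)

lemma dominating_set_from_vertices:
  assumes "dominating_set V E D"
  obtains S where "dominates S" "D = to_nat ` S"
proof -
  have "D \<subseteq> to_nat ` vertices" using assms by (simp add: dominating_set_def V_def)
  then obtain S where "S \<subseteq> vertices" "D = to_nat ` S" by (auto simp: subset_image_iff)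
  thus ?thesis using that assms dominating_set_image_iff by blast
qed

text \<open>Select the whole \<open>False\<close> side, all hooks, every third inner vertex of each
  path counted from its \<open>False\<close> end, and the centre of the star.\<close>

lemma domination_number_le: "domination_number V E \<le> 3 * N + 2 * card R * k + 1"
proof -
  define I where "I = (R \<times> (UNIV :: bool set)) \<times> {..<k}"
  define S where "S = (\<lambda>u. Orig u False) ` {..<N} \<union> case_prod Hook ` ({..<N} \<times> UNIV)
     \<union> (\<lambda>(((u, v), c), i). Path u v c (3 * i + 3)) ` I \<union> {Star 0}"
  have inner: "Path u v c q \<in> S" if "(u, v) \<in> R" "0 < q" "q mod 3 = 0" "q < 3 * k + 1" for u v c q
  proof -
    have "(((u, v), c), q div 3 - 1) \<in> I" using that by (auto simp: I_def)
    from imageI[OF this, of "\<lambda>(((u, v), c), i). Path u v c (3 * i + 3)"]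
    have "Path u v c (3 * (q div 3 - 1) + 3) \<in> S" unfolding S_def by simp
    moreover have "3 * (q div 3 - 1) + 3 = q" using that by presburger
    ultimately show ?thesis by simp
  qed
  have "dominates S" unfolding dominates_def
  proof (intro conjI ballI)
    show "S \<subseteq> vertices" using r by (auto simp: S_def I_def)
    fix x assume x: "x \<in> vertices"
    show "x \<in> S \<or> set (ports x) \<inter> S \<noteq> {}"
    proof (cases x)
      case (Orig u i)
      thus ?thesis using x by (cases i) (auto simp: S_def)
    next
      case (Path u v c p)
      hence p: "(u, v) \<in> R" "1 \<le> p" "p \<le> 3 * k + 1" using x by auto
      \<comment> \<open>Position 1 is dominated by the \<open>False\<close> end; every other
        position is within distance one of a multiple of 3 between 3 and
        \<open>3 * k\<close>.\<close>
      hence "p = 1 \<or> (p mod 3 = 0 \<and> p < 3 * k + 1) \<or> ((p + 1) mod 3 = 0 \<and> p + 1 < 3 * k + 1)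
        \<or> ((p - 1) mod 3 = 0 \<and> 0 < p - 1 \<and> p - 1 < 3 * k + 1)"
        by presburger
      then consider "p = 1" | "p mod 3 = 0" "p < 3 * k + 1" | "(p + 1) mod 3 = 0" "p + 1 < 3 * k + 1"
        | "(p - 1) mod 3 = 0" "0 < p - 1" "p - 1 < 3 * k + 1"
        by metis
      thus ?thesis
      proof cases
        case 1
        have "Orig u False \<in> S" using p(1) R_less by (auto simp: S_def)
        thus ?thesis using 1 Path by (auto simp: path_pos_def)
      next
        case 2
        thus ?thesis using inner[OF p(1)] p Path by auto
      next
        case 3
        thus ?thesis using inner[OF p(1), of "p + 1" c] p Path by (auto simp: path_pos_def)
      next
        case 4
        thus ?thesis using inner[OF p(1), of "p - 1" c] p Path by (auto simp: path_pos_def)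
      qed
    qed (use x in \<open>auto simp: S_def\<close>)
  qed
  hence dom: "dominating_set V E (to_nat ` S)"
    using dominating_set_image_iff by (auto simp: dominates_def)
  have "finite {D. dominating_set V E D}"
    by (rule finite_subset[of _ "Pow V"])
      (auto simp: dominating_set_def V_def finite_vertices)
  hence "domination_number V E \<le> card (to_nat ` S)"
    unfolding domination_number_def using dom by (intro Min_le) auto
  also have "\<dots> \<le> card S"
    by (rule card_image_le) (auto simp: S_def I_def finite_R)
  also have "\<dots> \<le> N + 2 * N + 2 * card R * k + 1"
  proof -
    have "card ((\<lambda>u. Orig u False) ` {..<N}) \<le> N"
      by (rule order_trans[OF card_image_le]) auto
    moreover have "card (case_prod Hook ` ({..<N} \<times> UNIV)) \<le> 2 * N"
      by (rule order_trans[OF card_image_le]) (auto simp: card_cartesian_product)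
    moreover have "card ((\<lambda>(((u, v), c), i). Path u v c (3 * i + 3)) ` I) \<le> 2 * card R * k"
      by (rule order_trans[OF card_image_le]) (auto simp: card_cartesian_product I_def finite_R)
    ultimately show ?thesis unfolding S_def
      by (intro order_trans[OF card_Un_le] add_mono) auto
  qed
  finally show ?thesis by simp
qed

text \<open>Disjoint parts of \<open>S\<close> are counted separately: inner path vertices, one of
  hook and leaf for each of the \<open>2 * N\<close> originals, and the selected originals. The last
  term is the surcharge for paths with no selected end, two copies per pair.\<close>

lemma dominates_card_ge:
  assumes S: "dominates S"
  defines "X \<equiv> \<lambda>i. {u \<in> {..<N}. Orig u i \<in> S}"
  shows "2 * card R * k + 2 * N + card (X False) + card (X True)
     + 2 * card (R \<inter> ({..<N} - X False) \<times> ({..<N} - X True)) \<le> card S"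
proof -
  define Q where "Q = (\<lambda>((u, v), c). {p. Path u v c p \<in> S})"
  let ?paths = "(\<lambda>(((u, v), c), p). Path u v c p) ` (SIGMA e:R \<times> UNIV. Q e)"
  let ?hooks = "S \<inter> (case_prod Hook ` ({..<N} \<times> UNIV) \<union> case_prod Leaf ` ({..<N} \<times> UNIV))"
  let ?orig = "\<lambda>i. (\<lambda>u. Orig u i) ` X i"
  let ?e = "\<lambda>((u, v), c :: bool). of_bool (u \<notin> X False \<and> v \<notin> X True) :: nat"
  have finS: "finite S" using S finite_vertices finite_subset by (auto simp: dominates_def)
  have Qsub: "Q e \<subseteq> {1..3 * k + 1}" for e
    using S by (auto simp: Q_def dominates_def split: prod.splits)
  have finQ: "finite (Q e)" for e using Qsub finite_subset by blast
  have path: "k + ?e e \<le> card (Q e)" if "e \<in> R \<times> UNIV" for e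
  proof -
    obtain u v c where e: "e = ((u, v), c)" by (cases e) auto
    hence uv: "(u, v) \<in> R" using that by simp
    have "k + of_bool (\<not> u \<in> X False \<and> \<not> v \<in> X True) \<le> card (Q e)"
    proof (rule path_domination[OF Qsub])
      fix p assume p: "1 \<le> p" "p \<le> 3 * k + 1"
      hence "Path u v c p \<in> vertices" using uv by simp
      hence "Path u v c p \<in> S \<or> path_pos u v c (p - 1) \<in> S \<or> path_pos u v c (p + 1) \<in> S"
        using S unfolding dominates_def by (cases c) fastforce+
      thus "p \<in> Q e \<or> p - 1 \<in> Q e \<or> p + 1 \<in> Q e \<or> p = 1 \<and> u \<in> X False \<or> p = 3 * k + 1 \<and> v \<in> X True"
        using p uv R_less by (auto simp: path_pos_def Q_def e X_def split: if_splits)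
    qed
    thus ?thesis by (simp add: e)
  qed
  have "2 * card R * k + 2 * card (R \<inter> ({..<N} - X False) \<times> ({..<N} - X True))
      = (\<Sum>e\<in>R \<times> UNIV. k + ?e e)"
  proof -
    have "(\<Sum>e\<in>R \<times> UNIV. ?e e) = (\<Sum>e\<in>R. \<Sum>c\<in>UNIV. ?e (e, c))"
      by (simp add: sum.cartesian_product)
    also have "\<dots> = 2 * (\<Sum>(u, v)\<in>R. of_bool (u \<notin> X False \<and> v \<notin> X True))"
      by (simp add: sum_distrib_left case_prod_unfold)
    also have "(\<Sum>(u, v)\<in>R. of_bool (u \<notin> X False \<and> v \<notin> X True))
        = card (R \<inter> {(u, v). u \<notin> X False \<and> v \<notin> X True})"
      using finite_R by (simp add: of_bool_def case_prod_unfold sum.If_cases Int_def)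
    also have "R \<inter> {(u, v). u \<notin> X False \<and> v \<notin> X True}
        = R \<inter> ({..<N} - X False) \<times> ({..<N} - X True)"
      using R_less by auto
    finally show ?thesis by (simp add: sum.distrib card_cartesian_product)
  qed
  also have "\<dots> \<le> (\<Sum>e\<in>R \<times> UNIV. card (Q e))" by (rule sum_mono[OF path])
  also have "\<dots> = card (SIGMA e:R \<times> UNIV. Q e)"
    using finQ finite_R by (subst card_SigmaI) auto
  also have "\<dots> = card ?paths"
    by (subst card_image) (auto simp: inj_on_def)
  finally have paths: "2 * card R * k + 2 * card (R \<inter> ({..<N} - X False) \<times> ({..<N} - X True))
      \<le> card ?paths" .
  have hooks: "2 * N \<le> card ?hooks"
  proof -
    \<comment> \<open>Identifies each hook with its leaf; \<open>undefined\<close> is the value on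
      constructors that do not occur in \<open>?hooks\<close>.\<close>
    define f where "f x = (case x of Hook u i \<Rightarrow> (u, i) | Leaf u i \<Rightarrow> (u, i) | _ \<Rightarrow> undefined)" for x
    have "(u, i) \<in> f ` ?hooks" if "u < N" for u i
    proof -
      have "Leaf u i \<in> vertices" using that by simp
      hence "Leaf u i \<in> S \<or> Hook u i \<in> S" using S unfolding dominates_def by fastforce
      hence "Leaf u i \<in> ?hooks \<or> Hook u i \<in> ?hooks" using that by (auto simp: image_iff)
      moreover have "f (Leaf u i) = (u, i)" "f (Hook u i) = (u, i)" by (simp_all add: f_def)
      ultimately show ?thesis by (metis imageI)
    qed
    hence "card ({..<N} \<times> (UNIV :: bool set)) \<le> card (f ` ?hooks)"
      using finS by (intro card_mono) auto
    also have "\<dots> \<le> card ?hooks" using finS by (intro card_image_le) auto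
    finally show ?thesis by (simp add: card_cartesian_product)
  qed
  have orig: "card (?orig i) = card (X i)" for i
    by (rule card_image) (auto simp: inj_on_def)
  have finpaths: "finite ?paths" using finQ finite_R by (intro finite_imageI finite_SigmaI) auto
  have "card (?paths \<union> (?hooks \<union> (?orig False \<union> ?orig True)))
      = card ?paths + (card ?hooks + (card (?orig False) + card (?orig True)))"
  proof -
    have "card (?orig False \<union> ?orig True) = card (?orig False) + card (?orig True)"
      by (rule card_Un_disjoint) (auto simp: X_def)
    moreover have "card (?hooks \<union> (?orig False \<union> ?orig True)) = card ?hooks + card (?orig False \<union> ?orig True)"
      using finS by (intro card_Un_disjoint) (auto simp: X_def)
    moreover have "card (?paths \<union> (?hooks \<union> (?orig False \<union> ?orig True)))
        = card ?paths + card (?hooks \<union> (?orig False \<union> ?orig True))"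
      using finS finpaths by (intro card_Un_disjoint) (auto simp: X_def)
    ultimately show ?thesis by simp
  qed
  moreover have "card (?paths \<union> (?hooks \<union> (?orig False \<union> ?orig True))) \<le> card S"
    using finS by (intro card_mono) (auto simp: Q_def X_def)
  ultimately show ?thesis using paths hooks by (simp add: orig)
qed

text \<open>Fewer than \<open>N/4\<close> points of \<open>A\<close> lack a partner in
  \<open>B\<close>, for otherwise they would be joined to \<open>B\<close>; each remaining point
  yields a pair.\<close>

lemma card_joined_ge:
  assumes "well_joined N R" "A \<subseteq> {..<N}" "B \<subseteq> {..<N}" "N \<le> 4 * card B"
  shows "real (card A) - real N / 4 \<le> real (card (R \<inter> A \<times> B))"
proof -
  let ?A = "fst ` (R \<inter> A \<times> B)"
  have finA: "finite A" using assms(2) finite_subset by blast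
  have "R \<inter> (A - ?A) \<times> B = {}" by force
  hence "\<not> N \<le> 4 * card (A - ?A)"
    using assms unfolding well_joined_def by (metis Diff_subset order_trans)
  moreover have "card A - card ?A \<le> card (A - ?A)"
    using finite_R by (intro diff_card_le_card_Diff) auto
  moreover have "card ?A \<le> card (R \<inter> A \<times> B)" using finite_R by (intro card_image_le) auto
  ultimately have "4 * card A \<le> 4 * card (R \<inter> A \<times> B) + N" by linarith
  thus ?thesis by simp
qed

text \<open>If at least \<open>N/4\<close> vertices of the \<open>True\<close> side are unselected,
  the surcharge grows with the unselected part of the \<open>False\<close> side. Otherwise more than
  \<open>3/4 * N\<close> vertices of the \<open>True\<close> side are selected, and up to the
  imbalance equally many on the other. Either way a balanced set costs about \<open>N/2\<close> more
  than a one-sided one.\<close>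

lemma dominates_card_ge_imbalance:
  assumes "dominates S" "well_joined N R"
  defines "X \<equiv> \<lambda>i. {u \<in> {..<N}. Orig u i \<in> S}"
  shows "2 * real (card R) * real k + 7 / 2 * real N - \<bar>real (card (X False)) - real (card (X True))\<bar>
     \<le> real (card S)"
proof -
  let ?C = "\<lambda>i. {..<N} - X i"
  let ?e = "card (R \<inter> ?C False \<times> ?C True)"
  have "card (?C i) = N - card (X i)" "card (X i) \<le> N" for i
  proof -
    have "X i \<subseteq> {..<N}" by (auto simp: X_def)
    thus "card (?C i) = N - card (X i)" "card (X i) \<le> N"
      using card_mono[of "{..<N}" "X i"] by (auto simp: card_Diff_subset finite_subset)
  qed
  hence C: "real (card (?C i)) = real N - real (card (X i))" for i by simp
  have "2 * card R * k + 2 * N + card (X False) + card (X True) + 2 * ?e \<le> card S"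
    using dominates_card_ge[OF assms(1)] unfolding X_def .
  hence "real (2 * card R * k + 2 * N + card (X False) + card (X True) + 2 * ?e) \<le> real (card S)"
    by (rule of_nat_mono)
  hence S: "2 * real (card R) * real k + 2 * real N + real (card (X False)) + real (card (X True))
      + 2 * real ?e \<le> real (card S)" by simp
  show ?thesis
  proof (cases "N \<le> 4 * card (?C True)")
    case True
    have "real (card (?C False)) - real N / 4 \<le> real ?e"
      by (rule card_joined_ge[OF assms(2) _ _ True]) auto
    thus ?thesis using S C[of False] by (simp add: abs_if)
  next
    case False
    hence "4 * real (card (?C True)) \<le> real N" by simp
    thus ?thesis using S C[of True] by (simp add: abs_if)
  qed
qed

end

section \<open>Overlapping neighbourhoods\<close>

lemma relpow_image_card_le:
  fixes R :: "('a \<times> 'a) set"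
  assumes "\<And>u. finite (R `` {u})" "\<And>u. card (R `` {u}) \<le> \<Delta>"
  shows "finite ((R ^^ m) `` {u}) \<and> card ((R ^^ m) `` {u}) \<le> \<Delta> ^ m"
proof (induction m)
  case (Suc m)
  have eq: "(R ^^ Suc m) `` {u} = (\<Union>w\<in>(R ^^ m) `` {u}. R `` {w})" by auto
  have "card ((R ^^ Suc m) `` {u}) \<le> (\<Sum>w\<in>(R ^^ m) `` {u}. card (R `` {w}))"
    unfolding eq using Suc by (intro card_UN_le) auto
  also have "\<dots> \<le> card ((R ^^ m) `` {u}) * \<Delta>"
    using sum_bounded_above[of "(R ^^ m) `` {u}" "\<lambda>w. card (R `` {w})" \<Delta>] assms(2) by simp
  also have "\<dots> \<le> \<Delta> ^ Suc m" using Suc by simp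
  finally show ?case using Suc assms(1) eq by simp
qed auto

context subdivided_cover
begin

text \<open>A relation, since an inner path vertex has a distance to each of its two ends. Both
  sides and the pendant vertices over \<open>v\<close> are collapsed to distance 0, which only
  enlarges the sets described by \<open>near\<close>.\<close>

fun offset :: "nat \<Rightarrow> vertex \<Rightarrow> nat \<Rightarrow> bool" where
  "offset w (Orig v i) d \<longleftrightarrow> w = v \<and> d = 0"
| "offset w (Hook v i) d \<longleftrightarrow> w = v \<and> d = 0"
| "offset w (Leaf v i) d \<longleftrightarrow> w = v \<and> d = 0"
| "offset w (Path a b c p) d \<longleftrightarrow> (w = a \<and> d = p) \<or> (w = b \<and> d = 3 * k + 2 - p)"
| "offset w (Star j) d \<longleftrightarrow> False"

text \<open>Contains the balls of radius \<open>t\<close> around both originals over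
  \<open>u\<close>: every step of \<open>R\<close> costs a full path of length
  \<open>3 * k + 2\<close>.\<close>

definition near :: "nat \<Rightarrow> nat \<Rightarrow> vertex \<Rightarrow> bool" where
  "near u t x \<longleftrightarrow> (\<exists>j w d. (u, w) \<in> R ^^ j \<and> offset w x d \<and> (3 * k + 2) * j + d \<le> t)"

lemma nearI: "(u, w) \<in> R ^^ j \<Longrightarrow> offset w x d \<Longrightarrow> (3 * k + 2) * j + d \<le> t \<Longrightarrow> near u t x"
  unfolding near_def by blast

lemma near_mono: "near u t x \<Longrightarrow> t \<le> s \<Longrightarrow> near u s x"
  unfolding near_def by (meson order_trans)

text \<open>At the far end of a path the offset \<open>3 * k + 2\<close> is traded for one more step
  of \<open>R\<close>.\<close>

lemma near_path_pos:
  assumes "(a, b) \<in> R" "q \<le> 3 * k + 2"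
  shows "(u, a) \<in> R ^^ j \<Longrightarrow> near u ((3 * k + 2) * j + q) (path_pos a b c q)"
    and "(u, b) \<in> R ^^ j \<Longrightarrow> near u ((3 * k + 2) * j + (3 * k + 2 - q)) (path_pos a b c q)"
proof -
  consider "q = 0" | "q = 3 * k + 2" | "q \<noteq> 0" "q \<noteq> 3 * k + 2" by blast
  note cases = this
  show "near u ((3 * k + 2) * j + q) (path_pos a b c q)" if a: "(u, a) \<in> R ^^ j"
    using cases
  proof cases
    case 2
    have "(u, b) \<in> R ^^ Suc j" using a assms(1) by auto
    thus ?thesis by (rule nearI[where d = 0]) (simp_all add: path_pos_def 2)
  qed (rule nearI[OF a, where d = q]; simp add: path_pos_def)+
  show "near u ((3 * k + 2) * j + (3 * k + 2 - q)) (path_pos a b c q)" if b: "(u, b) \<in> R ^^ j"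
    using cases
  proof cases
    case 1
    have "(u, a) \<in> R ^^ Suc j" using b assms(1) R_sym by auto
    thus ?thesis by (rule nearI[where d = 0]) (simp_all add: path_pos_def 1)
  qed (rule nearI[OF b, where d = "3 * k + 2 - q"]; simp add: path_pos_def)+
qed

lemma near_step:
  assumes "near u t x" "x \<in> vertices" "y \<in> set (ports x)"
  shows "near u (Suc t) y"
proof -
  obtain j w d where w: "(u, w) \<in> R ^^ j" "offset w x d" "(3 * k + 2) * j + d \<le> t"
    using assms(1) by (auto simp: near_def)
  show ?thesis
  proof (cases x rule: ports.cases)
    case (1 v)
    hence "offset w y 0 \<or> offset w y 1" using assms(3) w(2) by auto
    thus ?thesis using nearI[OF w(1)] w 1 by auto
  next
    case (2 v)
    hence "offset w y 0 \<or> offset w y 1" using assms(3) w(2) by auto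
    thus ?thesis using nearI[OF w(1)] w 2 by auto
  next
    case (3 v i)
    hence "offset w y 0" using assms(3) w(2) by auto
    thus ?thesis using nearI[OF w(1)] w by auto
  next
    case (4 v i)
    hence "offset w y 0" using assms(3) w(2) by auto
    thus ?thesis using nearI[OF w(1)] w by auto
  next
    case (5 a b c p)
    have p: "(a, b) \<in> R" "1 \<le> p" "p \<le> 3 * k + 1" using 5 assms(2) by auto
    have "y = path_pos a b c (p - 1) \<or> y = path_pos a b c (p + 1)"
      using assms(3) 5 by (auto split: if_splits)
    then obtain q where q: "y = path_pos a b c q" "q \<le> p + 1" "p \<le> q + 1" by auto
    have q': "q \<le> 3 * k + 2" using q p by simp
    have "(w = a \<and> d = p) \<or> (w = b \<and> d = 3 * k + 2 - p)" using w(2) 5 by simp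
    thus ?thesis
    proof (elim disjE conjE)
      assume wd: "w = a" "d = p"
      show ?thesis using near_mono[OF near_path_pos(1)[OF p(1) q', of u j c], of "Suc t"] w wd q by simp
    next
      assume wd: "w = b" "d = 3 * k + 2 - p"
      have "3 * k + 2 - q \<le> Suc d" using wd q by linarith
      thus ?thesis using near_mono[OF near_path_pos(2)[OF p(1) q', of u j c], of "Suc t"] w wd q by simp
    qed
  next
    case (6 j)
    thus ?thesis using w(2) by simp
  qed
qed

lemma near_reach:
  assumes "near u s x" "x \<in> vertices" "n \<in> reach P t (to_nat x)"
  shows "near u (s + t) (from_nat n)"
  using assms
proof (induction t arbitrary: s x)
  case (Suc t)
  show ?case
  proof (cases "n \<in> reach P t (to_nat x)")
    case True
    thus ?thesis using Suc.IH[OF Suc.prems(1,2)] by (auto elim: near_mono)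
  next
    case False
    then obtain y where y: "y \<in> set (ports x)" "n \<in> reach P t (to_nat y)"
      using Suc.prems(3) by (auto simp: P_def[of "to_nat x"])
    have "near u (Suc s) y" by (rule near_step[OF Suc.prems(1,2) y(1)])
    moreover have "y \<in> vertices" using ports_closed[OF Suc.prems(2)] y(1) by auto
    ultimately show ?thesis using Suc.IH[of "Suc s" y] y(2) by simp
  qed
qed simp

lemma relpow_less: "(u, w) \<in> R ^^ j \<Longrightarrow> u < N \<Longrightarrow> w < N"
  by (induction j arbitrary: w) (auto dest: R_less)

lemma relpow_sym: "(u, w) \<in> R ^^ j \<Longrightarrow> (w, u) \<in> R ^^ j"
proof (induction j arbitrary: w)
  case (Suc j)
  then obtain y where "(u, y) \<in> R ^^ j" "(y, w) \<in> R" by auto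
  hence "(w, y) \<in> R" "(y, u) \<in> R ^^ j" using Suc.IH R_sym by auto
  thus ?case by (rule relpow_Suc_I2)
qed simp

lemma relpow_mono:
  assumes "(u, w) \<in> R ^^ j" "u < N" "j \<le> m"
  shows "(u, w) \<in> R ^^ m"
  using assms(3,1)
proof (induction m rule: dec_induct)
  case (step m)
  thus ?case using relpow_less[OF _ assms(2)] R(3) by auto
qed simp

text \<open>Each walk has at most \<open>t div (3 * k + 2)\<close> steps. Their end points
  \<open>w\<close> and \<open>w'\<close> coincide or bound a common path; in both cases
  \<open>R\<close> relates them, with loops covering equality. This connecting step is the
  \<open>+ 1\<close>.\<close>

lemma near_both:
  assumes "near u t x" "near v t x" "x \<in> vertices" "u < N"
  shows "(u, v) \<in> R ^^ (2 * (t div (3 * k + 2)) + 1)"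
proof -
  obtain j w d where w: "(u, w) \<in> R ^^ j" "offset w x d" "(3 * k + 2) * j + d \<le> t"
    using assms(1) by (auto simp: near_def)
  obtain j' w' d' where w': "(v, w') \<in> R ^^ j'" "offset w' x d'" "(3 * k + 2) * j' + d' \<le> t"
    using assms(2) by (auto simp: near_def)
  have j: "j \<le> t div (3 * k + 2)" "j' \<le> t div (3 * k + 2)"
    using w(3) w'(3) by (auto simp: less_eq_div_iff_mult_less_eq mult.commute)
  have "(w, w') \<in> R"
    proof (cases x)
    case (Path a b c p)
    hence "(a, b) \<in> R" using assms(3) by simp
    hence "(a, b) \<in> R" "(b, a) \<in> R" "(a, a) \<in> R" "(b, b) \<in> R"
      using R_sym R_less R(3) by blast+
    thus ?thesis using w(2) w'(2) Path by auto
  qed (use w(2) w'(2) assms(3) R(3) in auto)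
  hence "(u, w') \<in> R ^^ (Suc j)" using w(1) by auto
  moreover have "(w', v) \<in> R ^^ j'"
    using w'(1) by (rule relpow_sym)
  ultimately have "(u, v) \<in> R ^^ (Suc j + j')" by (metis relcompI relpow_add)
  thus ?thesis by (rule relpow_mono[OF _ assms(4)]) (use j in simp)
qed

end

section \<open>The lower bound\<close>

text \<open>Completing the square turns a second moment into a bound on the absolute value. The
  weights keep the constant part \<open>N/8\<close> well below the gap \<open>N/2\<close>.\<close>

lemma abs_le_quadratic:
  fixes z :: real and N :: nat
  assumes "N > 0"
  shows "\<bar>z\<bar> \<le> real N / 8 + 2 / real N * z\<^sup>2"
proof -
  have "0 \<le> (\<bar>z\<bar> - real N / 4)\<^sup>2" by simp
  also have "\<dots> = z\<^sup>2 - real N / 2 * \<bar>z\<bar> + (real N)\<^sup>2 / 16"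
    by (simp add: power2_diff power_divide)
  finally have "real N / 2 * \<bar>z\<bar> \<le> (real N)\<^sup>2 / 16 + z\<^sup>2" by simp
  hence "2 / real N * (real N / 2 * \<bar>z\<bar>) \<le> 2 / real N * ((real N)\<^sup>2 / 16 + z\<^sup>2)"
    by (rule mult_left_mono) simp
  also have "2 / real N * ((real N)\<^sup>2 / 16 + z\<^sup>2) = real N / 8 + 2 / real N * z\<^sup>2"
    using assms by (simp add: field_simps power2_eq_square)
  finally show ?thesis using assms by simp
qed

text \<open>A nonempty set of extended naturals contains its infimum, so a finite round complexity
  is itself a valid number of rounds.\<close>

lemma round_complexity_attained:
  assumes "round_complexity A n \<noteq> \<infinity>"
  shows "\<exists>T. round_complexity A n = enat T \<and> (\<forall>V E P. network V E P \<and> card V = n \<longrightarrow>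
      (AE \<omega> in random_tapes V. \<forall>v\<in>V. decision_at A V P \<omega> T v \<noteq> None))"
proof -
  let ?S = "{enat t |t. \<forall>V E P. network V E P \<and> card V = n \<longrightarrow>
     (AE \<omega> in random_tapes V. \<forall>v\<in>V. decision_at A V P \<omega> t v \<noteq> None)}"
  have "?S \<noteq> {}"
  proof
    assume "?S = {}"
    hence "round_complexity A n = Inf {}" unfolding round_complexity_def by (rule arg_cong)
    thus False using assms by (simp add: Inf_enat_def)
  qed
  then obtain s where "s \<in> ?S" by blast
  hence "round_complexity A n \<in> ?S" unfolding round_complexity_def by (rule wellorder_InfI)
  thus ?thesis by blast
qed

context subdivided_cover
begin

lemma symmetric:
  "randomized_local_algorithm A \<Longrightarrow> symmetric_network A V E P \<sigma>"
  using network involution by unfold_locales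

text \<open>A common vertex of two zones is near both points, which bounds their
  \<open>R\<close>-distance; powers of a relation of bounded degree grow at most
  geometrically.\<close>

lemma card_zone_overlap:
  fixes T :: nat
  assumes alg: "randomized_local_algorithm A"
    and deg: "\<And>u. card (R `` {u}) \<le> \<Delta>" and u: "u < N"
  defines "X \<equiv> (\<lambda>u. to_nat (Orig u False)) ` {..<N}"
    and "Zn \<equiv> symmetric_network.zone P \<sigma> T"
  shows "card {y \<in> X. Zn (to_nat (Orig u False)) \<inter> Zn y \<noteq> {}} \<le> \<Delta> ^ (2 * (T div (3 * k + 2)) + 1)"
proof -
  let ?m = "2 * (T div (3 * k + 2)) + 1"
  have zone: "near v T (from_nat n) \<and> from_nat n \<in> vertices"
    if n: "n \<in> Zn (to_nat (Orig v False))" and v: "v < N" for v n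
  proof -
    obtain i where i: "n \<in> reach P T (to_nat (Orig v i))"
      using n unfolding Zn_def symmetric_network.zone_def[OF symmetric[OF alg]] \<sigma>_def by auto
    have "near v 0 (Orig v i)" by (rule nearI[where j = 0 and d = 0]) auto
    from near_reach[OF this _ i] v have "near v T (from_nat n)" by simp
    moreover have "n \<in> V"
      using reach_subset[OF port_closed_network[OF network], of "to_nat (Orig v i)" T] i v
      by (auto simp: V_def)
    ultimately show ?thesis by (auto simp: V_def)
  qed
  have "{y \<in> X. Zn (to_nat (Orig u False)) \<inter> Zn y \<noteq> {}}
      \<subseteq> (\<lambda>v. to_nat (Orig v False)) ` ((R ^^ ?m) `` {u})"
  proof
    fix y assume "y \<in> {y \<in> X. Zn (to_nat (Orig u False)) \<inter> Zn y \<noteq> {}}"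
    then obtain v n where v: "y = to_nat (Orig v False)" "v < N"
      "n \<in> Zn (to_nat (Orig u False))" "n \<in> Zn (to_nat (Orig v False))"
      by (auto simp: X_def)
    have "(u, v) \<in> R ^^ ?m" using zone[OF v(3) u] zone[OF v(4,2)] near_both u by blast
    thus "y \<in> (\<lambda>v. to_nat (Orig v False)) ` ((R ^^ ?m) `` {u})" using v(1) by blast
  qed
  moreover have fin: "finite ((R ^^ ?m) `` {u})" and le: "card ((R ^^ ?m) `` {u}) \<le> \<Delta> ^ ?m"
    using relpow_image_card_le[OF finite_R_image deg] by blast+
  ultimately show ?thesis
    by (meson card_image_le card_mono finite_imageI order_trans)
qed

text \<open>The expected output size is bounded below by the imbalance estimate and above by the
  approximation guarantee. The coefficient \<open>27/8 = 7/2 - 1/8\<close> includes the loss from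
  bounding the imbalance by its square, whose expectation contributes the power of
  \<open>\<Delta>\<close>.\<close>

lemma approximation_lower_bound:
  assumes alg: "randomized_local_algorithm A" and approx: "approximates_dominating_set A \<epsilon>"
    and eps: "\<epsilon> > 0"
    and decided: "AE \<omega> in random_tapes V. \<forall>v\<in>V. decision_at A V P \<omega> T v \<noteq> None"
    and joined: "well_joined N R" and deg: "\<And>u. card (R `` {u}) \<le> \<Delta>" and N: "N > 0"
  shows "2 * real (card R) * real k + 27 / 8 * real N - 2 * real \<Delta> ^ (2 * (T div (3 * k + 2)) + 1)
     \<le> (1 + \<epsilon>) * (3 * real N + 2 * real (card R) * real k + 1)"
proof -
  interpret prob_space "random_tapes V" by (rule prob_space_random_tapes)
  interpret symmetric_network A V E P \<sigma> T by (rule symmetric[OF alg])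
  define X where "X = (\<lambda>u. to_nat (Orig u False)) ` {..<N}"
  define B where "B = real \<Delta> ^ (2 * (T div (3 * k + 2)) + 1)"
  define out where "out \<omega> = real (card (output_set A V P \<omega>))" for \<omega>
  define Z where "Z \<omega> = (\<Sum>x\<in>X. bias x \<omega>)" for \<omega>
  define c where "c = 2 * real (card R) * real k + 27 / 8 * real N"
  have finV: "finite V" using finite_vertices by (simp add: V_def)
  have XV: "X \<subseteq> V" "finite X" by (auto simp: X_def V_def)
  have cardX: "card X = N" unfolding X_def by (subst card_image) (auto simp: inj_on_def)
  have intZ: "integrable (random_tapes V) (\<lambda>\<omega>. (Z \<omega>)\<^sup>2)"
    unfolding Z_def by (rule second_moment_bias(1)[OF XV])
  have "expectation (\<lambda>\<omega>. (Z \<omega>)\<^sup>2) \<le> (\<Sum>x\<in>X. real (card {y \<in> X. zone x \<inter> zone y \<noteq> {}}))"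
    unfolding Z_def by (rule second_moment_bias(2)[OF XV])
  also have "\<dots> \<le> (\<Sum>x\<in>X. B)"
  proof (rule sum_mono)
    fix x assume "x \<in> X"
    then obtain u where u: "u < N" "x = to_nat (Orig u False)" by (auto simp: X_def)
    have "card {y \<in> X. zone x \<inter> zone y \<noteq> {}} \<le> \<Delta> ^ (2 * (T div (3 * k + 2)) + 1)"
      unfolding u(2) X_def by (rule card_zone_overlap[OF alg deg u(1)])
    hence "real (card {y \<in> X. zone x \<inter> zone y \<noteq> {}}) \<le> real (\<Delta> ^ (2 * (T div (3 * k + 2)) + 1))"
      by (rule of_nat_mono)
    thus "real (card {y \<in> X. zone x \<inter> zone y \<noteq> {}}) \<le> B"
      unfolding B_def by (simp only: of_nat_power)
  qed
  finally have EZ: "expectation (\<lambda>\<omega>. (Z \<omega>)\<^sup>2) \<le> real N * B" by (simp add: cardX)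
  have "AE \<omega> in random_tapes V. dominating_set V E (output_set A V P \<omega>)"
    using approx network unfolding approximates_dominating_set_def by (auto elim: AE_mp)
  hence "AE \<omega> in random_tapes V. c - 2 / real N * (Z \<omega>)\<^sup>2 \<le> out \<omega>"
    using decided
  proof eventually_elim
    case (elim \<omega>)
    obtain S where S: "dominates S" "output_set A V P \<omega> = to_nat ` S"
      using dominating_set_from_vertices[OF elim(1)] by blast
    let ?X = "\<lambda>i. {u \<in> {..<N}. Orig u i \<in> S}"
    have "joins A V P T (to_nat x) \<omega> = of_bool (x \<in> S)" if "x \<in> vertices" for x
    proof -
      have "to_nat x \<in> output_set A V P \<omega> \<longleftrightarrow> decision_at A V P \<omega> T (to_nat x) = Some True"
        unfolding output_set_decided[OF alg elim(2)] using that by (auto simp: V_def)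
      thus ?thesis unfolding S(2) by (simp add: joins_def inj_image_mem_iff)
    qed
    hence "bias (to_nat (Orig u False)) \<omega> = of_bool (Orig u False \<in> S) - of_bool (Orig u True \<in> S)"
      if "u < N" for u using that by (simp add: bias_def \<sigma>_def)
    hence "Z \<omega> = (\<Sum>u<N. of_bool (Orig u False \<in> S) - of_bool (Orig u True \<in> S))"
      unfolding Z_def X_def by (subst sum.reindex) (auto simp: inj_on_def)
    also have "\<dots> = real (card (?X False)) - real (card (?X True))"
      by (simp add: sum_subtractf of_bool_def sum.If_cases Int_def)
    finally have Z: "Z \<omega> = real (card (?X False)) - real (card (?X True))" .
    have "2 * real (card R) * real k + 7 / 2 * real N - \<bar>Z \<omega>\<bar> \<le> real (card S)"
      unfolding Z by (rule dominates_card_ge_imbalance[OF S(1) joined])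
    moreover have "out \<omega> = real (card S)" by (simp add: out_def S(2) card_image)
    ultimately show ?case using abs_le_quadratic[OF N, of "Z \<omega>"] by (simp add: c_def)
  qed
  moreover have "integrable (random_tapes V) out"
  proof (rule integrable_const_bound[of _ "real (card V)"])
    show "AE \<omega> in random_tapes V. norm (out \<omega>) \<le> real (card V)"
      using finV by (auto simp: out_def output_set_def intro!: card_mono)
    show "out \<in> borel_measurable (random_tapes V)"
      unfolding out_def[abs_def] by (rule card_output_set_measurable[OF alg network])
  qed
  ultimately have "expectation (\<lambda>\<omega>. c - 2 / real N * (Z \<omega>)\<^sup>2) \<le> expectation out"
    using intZ by (intro integral_mono_AE) auto
  also have "\<dots> \<le> (1 + \<epsilon>) * real (domination_number V E)"
    using approx network unfolding approximates_dominating_set_def out_def[abs_def] by blast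
  also have "\<dots> \<le> (1 + \<epsilon>) * (3 * real N + 2 * real (card R) * real k + 1)"
  proof (rule mult_left_mono)
    have "real (domination_number V E) \<le> real (3 * N + 2 * card R * k + 1)"
      using domination_number_le by (rule of_nat_mono)
    thus "real (domination_number V E) \<le> 3 * real N + 2 * real (card R) * real k + 1" by simp
  qed (use eps in simp)
  also have "expectation (\<lambda>\<omega>. c - 2 / real N * (Z \<omega>)\<^sup>2) = c - 2 / real N * expectation (\<lambda>\<omega>. (Z \<omega>)\<^sup>2)"
    using intZ prob_space by (subst Bochner_Integration.integral_diff) auto
  finally have "c - 2 / real N * expectation (\<lambda>\<omega>. (Z \<omega>)\<^sup>2)
      \<le> (1 + \<epsilon>) * (3 * real N + 2 * real (card R) * real k + 1)" .
  moreover have "2 / real N * expectation (\<lambda>\<omega>. (Z \<omega>)\<^sup>2) \<le> 2 / real N * (real N * B)"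
    by (rule mult_left_mono[OF EZ]) simp
  ultimately show ?thesis using N by (simp add: c_def B_def)
qed

end

text \<open>The first bound keeps \<open>\<epsilon>\<close> times the cost of all paths a small
  fraction of \<open>N\<close>; the second makes every step of \<open>R\<close> cost order
  \<open>1 / \<epsilon>\<close> rounds. It holds even if rounding gives \<open>k = 0\<close>, thanks
  to the summand 2.\<close>

lemma subdivision_length:
  fixes \<epsilon> :: real
  assumes "\<epsilon> > 0"
  defines "k \<equiv> nat \<lfloor>1 / (8000 * \<epsilon>)\<rfloor>"
  shows "8000 * \<epsilon> * real k \<le> 1" "1 \<le> 8000 * \<epsilon> * real (3 * k + 2)"
proof -
  have "real k \<le> 1 / (8000 * \<epsilon>)" using assms(1) by (simp add: k_def)
  thus "8000 * \<epsilon> * real k \<le> 1" using assms(1) by (simp add: field_simps)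
  have "1 / (8000 * \<epsilon>) \<le> real k + 1" using assms(1) unfolding k_def by linarith
  hence "1 / (8000 * \<epsilon>) \<le> real (3 * k + 2)" by simp
  thus "1 \<le> 8000 * \<epsilon> * real (3 * k + 2)" using assms(1) by (simp add: field_simps)
qed

text \<open>Since \<open>32000 = 4 * 8000\<close>, at most \<open>ln n / (4 * ln 400)\<close> full
  path lengths fit into \<open>T\<close> rounds. Doubling this exponent gives the square root; the
  connecting step gives the factor 400.\<close>

lemma ball_growth:
  fixes c \<epsilon> :: real
  assumes c: "c = 1 / (32000 * ln 400)" and eps: "\<epsilon> > 0" and n: "n \<ge> 1"
    and L: "1 \<le> 8000 * \<epsilon> * real L" and T: "real T < c * (ln (real n) / \<epsilon>)"
  shows "(400 :: real) ^ (2 * (T div L) + 1) \<le> 400 * sqrt (real n)"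
proof -
  have L0: "L > 0" using L by (cases L) auto
  have "real (T div L) \<le> real T / real L" using of_nat_div_le_of_nat[of T L, where 'a = real] by simp
  also have "\<dots> \<le> (c * (ln (real n) / \<epsilon>)) / real L"
    using T by (intro divide_right_mono) auto
  also have "\<dots> \<le> (c * (ln (real n) / \<epsilon>)) / real L * (8000 * \<epsilon> * real L)"
  proof -
    have "0 \<le> (c * (ln (real n) / \<epsilon>)) / real L" using c eps n by simp
    from mult_left_mono[OF L this] show ?thesis by simp
  qed
  also have "\<dots> = 8000 * c * ln (real n)" using L0 eps by (simp add: field_simps)
  also have "\<dots> = ln (real n) / (4 * ln 400)" by (simp add: c)
  finally have "2 * real (T div L) * ln 400 \<le> ln (real n) / 2"
    by (simp add: pos_le_divide_eq mult.commute)
  hence "exp (2 * real (T div L) * ln 400) \<le> exp (ln (real n) / 2)" by simp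
  also have "exp (ln (real n) / 2) = sqrt (real n)"
    using n by (simp add: ln_sqrt[symmetric])
  also have "exp (2 * real (T div L) * ln 400) = (400 :: real) ^ (2 * (T div L))"
    using exp_of_nat_mult[of "2 * (T div L)" "ln (400 :: real)"] by simp
  finally show ?thesis by simp
qed

theorem theoremB5:
  shows "\<exists>c::real. c > 0 \<and>
    (\<forall>(\<epsilon>::real) (A::local_alg).
       0 < \<epsilon> \<and> \<epsilon> \<le> 0.04 \<and>
       randomized_local_algorithm A \<and> approximates_dominating_set A \<epsilon> \<longrightarrow>
       (\<forall>\<^sub>F n in sequentially.
          ereal (c * (ln (real n) / \<epsilon>)) \<le> ereal_of_enat (round_complexity A n)))"
proof -
  define c :: real where "c = 1 / (32000 * ln 400)"
  have "\<forall>\<^sub>F n in sequentially. ereal (c * (ln (real n) / \<epsilon>)) \<le> ereal_of_enat (round_complexity A n)"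
    if eps: "0 < \<epsilon>" "\<epsilon> \<le> 0.04"
      and alg: "randomized_local_algorithm A" and approx: "approximates_dominating_set A \<epsilon>" for \<epsilon> A
  proof -
    define k where "k = nat \<lfloor>1 / (8000 * \<epsilon>)\<rfloor>"
    \<comment> \<open>Bounds the number of vertices outside the star per point of \<open>R\<close>,
      using \<open>card R \<le> 400 * N\<close>. It depends on \<open>\<epsilon>\<close> but not on
      \<open>n\<close>.\<close>
    define K where "K = 6 + 800 * (3 * k + 1)"
    have len: "8000 * \<epsilon> * real k \<le> 1" "1 \<le> 8000 * \<epsilon> * real (3 * k + 2)"
      using subdivision_length[OF eps(1)] unfolding k_def by blast+
    have K0: "real K > 0" by (simp add: K_def)
    \<comment> \<open>The final contradiction: \<open>0.155 = 27/8 - 3 - 0.1 - 3 * 0.04\<close> is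
      the surplus per point, \<open>1.04\<close> bounds \<open>1 + \<epsilon>\<close>, and
      \<open>800 * sqrt n\<close> bounds the overlap term. The number of points is at least
      \<open>(n - 1) / K - 1\<close>.\<close>
    have "\<forall>\<^sub>F n in sequentially. 1.04 + 800 * sqrt (real n) < 0.155 * ((real n - 1) / real K - 1)"
      using K0 by real_asymp
    moreover have "\<forall>\<^sub>F n in sequentially. n > K" by (rule eventually_gt_at_top)
    ultimately show ?thesis
    proof eventually_elim
      case (elim n)
      show ?case
      proof (rule ccontr)
        assume small: "\<not> ?thesis"
        have "round_complexity A n \<noteq> \<infinity>"
        proof
          assume "round_complexity A n = \<infinity>"
          thus False using small by simp
        qed
        from round_complexity_attained[OF this] obtain T where T: "round_complexity A n = enat T"
          "\<And>V E P. network V E P \<Longrightarrow> card V = n \<Longrightarrow>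
             AE \<omega> in random_tapes V. \<forall>v\<in>V. decision_at A V P \<omega> T v \<noteq> None"
          by blast
        have T_less: "real T < c * (ln (real n) / \<epsilon>)" using small T(1) by simp
        \<comment> \<open>Dividing \<open>n - 1\<close> instead of \<open>n\<close> leaves at least
          one vertex for the star.\<close>
        define N where "N = (n - 1) div K"
        have NK: "N * K < n" unfolding N_def using elim(2)
          by (metis div_times_less_eq_dividend diff_less gr_zeroI le_less_trans not_less_zero zero_less_one)
        have N0: "N > 0" unfolding N_def using elim(2) by (simp add: div_greater_zero_iff K_def)
        have "n - 1 < K * (N + 1)" unfolding N_def
          using K0 by (metis Suc_eq_plus1 dividend_less_times_div mult_Suc_right of_nat_0_less_iff add.commute)
        hence "real n - 1 \<le> real (K * (N + 1))" using elim(2) by linarith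
        hence "(real n - 1) / real K \<le> real N + 1" using K0 by (simp add: field_simps)
        hence "0.155 * ((real n - 1) / real K - 1) \<le> 0.155 * real N"
          by (intro mult_left_mono) auto
        hence N_large: "1.04 + 800 * sqrt (real n) < 0.155 * real N"
          by (rule less_le_trans[OF elim(1)])
        obtain R where H: "R \<subseteq> {..<N} \<times> {..<N}" "sym R" "\<And>u. u < N \<Longrightarrow> (u, u) \<in> R"
          "\<And>u. card (R `` {u}) \<le> 400" "well_joined N R"
          using ex_well_joined[OF N0] by blast
        have "finite (R `` {u})" for u
          by (rule finite_subset[of _ "{..<N}"]) (use H(1) in auto)
        hence "card (SIGMA u:{..<N}. R `` {u}) = (\<Sum>u<N. card (R `` {u}))"
          by (intro card_SigmaI) auto
        moreover have "(SIGMA u:{..<N}. R `` {u}) = R" using H(1) by auto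
        ultimately have "card R = (\<Sum>u<N. card (R `` {u}))" by simp
        also have "\<dots> \<le> (\<Sum>u<N. 400)" by (intro sum_mono H(4))
        finally have cR: "card R \<le> 400 * N" by simp
        \<comment> \<open>The star absorbs all remaining vertices, so that every large
          \<open>n\<close> is attained exactly.\<close>
        define r where "r = n - (6 * N + 2 * card R * (3 * k + 1))"
        have "6 * N + 2 * card R * (3 * k + 1) \<le> 6 * N + 2 * (400 * N) * (3 * k + 1)"
          using cR by (intro add_left_mono mult_right_mono mult_left_mono) auto
        also have "\<dots> = N * K" by (simp add: K_def algebra_simps)
        finally have used: "6 * N + 2 * card R * (3 * k + 1) < n" using NK by simp
        interpret subdivided_cover N k r R
          using H(1-3) used by unfold_locales (auto simp: r_def)
        have "card V = n" using card_V used r_def by linarith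
        note dec = T(2)[OF network this]
        have "2 * real (card R) * real k + 27 / 8 * real N
            - 2 * real 400 ^ (2 * (T div (3 * k + 2)) + 1)
          \<le> (1 + \<epsilon>) * (3 * real N + 2 * real (card R) * real k + 1)"
          by (rule approximation_lower_bound[OF alg approx eps(1) dec H(5,4) N0])
        moreover have "(400 :: real) ^ (2 * (T div (3 * k + 2)) + 1) \<le> 400 * sqrt (real n)"
          using elim(2) by (intro ball_growth[OF c_def eps(1) _ len(2) T_less]) simp
        moreover have "\<epsilon> * (2 * real (card R) * real k) \<le> 0.1 * real N"
        proof -
          have "\<epsilon> * (2 * real (card R) * real k) \<le> \<epsilon> * (2 * real (400 * N) * real k)"
            using eps(1) cR by (intro mult_left_mono mult_right_mono) (auto simp del: of_nat_mult)
          also have "\<dots> = 0.1 * real N * (8000 * \<epsilon> * real k)" by simp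
          also have "\<dots> \<le> 0.1 * real N * 1" by (rule mult_left_mono[OF len(1)]) simp
          finally show ?thesis by simp
        qed
        moreover have "\<epsilon> * (3 * real N + 1) \<le> 0.04 * (3 * real N + 1)"
          using eps(2) by (intro mult_right_mono) auto
        ultimately show False using N_large by (simp add: algebra_simps)
      qed
    qed
  qed
  moreover have "c > 0" by (simp add: c_def)
  ultimately show ?thesis by blast
qed

end
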